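(* Let $T\in\mathbb C^m\otimes\mathbb C^m\otimes\mathbb C^m$ be a concise tensor of minimal border rank (i.e. of border rank $m$). Then $T$ is wild if and only if $T$ is $1_*$-degenerate, i.e. if and only if $T$ is not $1$-generic.
   Context: Let $A,B,C$ be complex vector spaces of dimension $m$ and $T\in A\otimes B\otimes C$, viewed as linear maps $A^*\to B\otimes C$, $B^*\to A\otimes C$, $C^*\to A\otimes B$ with images $T(A^* ),T(B^* ),T(C^* )$. $T$ is concise if all three maps are injective. $T$ is $1_A$-generic if $T(A^* )$ contains an element of rank $m$, and $1_A$-degenerate otherwise (similarly for $B$, $C$). $T$ is $1$-generic if it is $1_A$-, $1_B$- and $1_C$-generic; $T$ is $1_*$-degenerate if it is at least one of $1_A$-, $1_B$-, $1_C$-degenerate. The border rank of $T$ is the smallest $r$ such that $T$ is a limit of sums of $r$ rank one tensors. The smoothable rank of $T$ is the minimal degree of a smoothable zero-dimensional subscheme $\mathrm{Spec}(R)\subseteq\mathbb PA\times\mathbb PB\times\mathbb PC\subseteq\mathbb P(A\otimes B\otimes C)$ (Segre embedding) with $T\in\langle\mathrm{Spec}(R)\rangle$, where $\langle\mathrm{Spec}(R)\rangle\subseteq A\otimes B\otimes C$ is the linear span, i.e. the common zero set of the linear forms in the homogeneous ideal of $\mathrm{Spec}(R)$. A zero-dimensional scheme $\mathrm{Spec}(R)$ of degree $r$ (equivalently the $r$-dimensional algebra $R$) is smoothable if it is a limit (in a flat family) of schemes consisting of $r$ reduced points. $T$ is wild if its smoothable rank is larger than its border rank. *)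

theory Defs
  imports
    "HOL-Analysis.Analysis"
    "HOL-Library.Poly_Mapping"
    "HOL-Library.Extended_Nat"
begin

section \<open>Tensors\<close>

text \<open>
  Coordinates with respect to fixed bases of \<open>A\<close>, \<open>B\<close>, \<open>C\<close>, all three of dimension
  \<open>m = CARD('n)\<close>: the entry \<open>T $ i $ j $ k\<close> is the coefficient of \<open>a\<^sub>i \<otimes> b\<^sub>j \<otimes> c\<^sub>k\<close>.
  Elements of the dual spaces are written in the dual bases, and elements of \<open>B \<otimes> C\<close> etc.
  are matrices.
\<close>

type_synonym 'n tensor = "complex ^ 'n ^ 'n ^ 'n"

definition slice_A :: "'n::finite tensor \<Rightarrow> complex ^ 'n \<Rightarrow> complex ^ 'n ^ 'n" where
  "slice_A T \<alpha> = (\<chi> j k. \<Sum>i\<in>UNIV. \<alpha> $ i * T $ i $ j $ k)"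

definition slice_B :: "'n::finite tensor \<Rightarrow> complex ^ 'n \<Rightarrow> complex ^ 'n ^ 'n" where
  "slice_B T \<beta> = (\<chi> i k. \<Sum>j\<in>UNIV. \<beta> $ j * T $ i $ j $ k)"

definition slice_C :: "'n::finite tensor \<Rightarrow> complex ^ 'n \<Rightarrow> complex ^ 'n ^ 'n" where
  "slice_C T \<gamma> = (\<chi> i j. \<Sum>k\<in>UNIV. \<gamma> $ k * T $ i $ j $ k)"

definition concise :: "'n::finite tensor \<Rightarrow> bool" where
  "concise T \<longleftrightarrow> inj (slice_A T) \<and> inj (slice_B T) \<and> inj (slice_C T)"

definition one_A_generic :: "'n::finite tensor \<Rightarrow> bool" where
  "one_A_generic T \<longleftrightarrow> (\<exists>M \<in> range (slice_A T). rank M = CARD('n))"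

definition one_B_generic :: "'n::finite tensor \<Rightarrow> bool" where
  "one_B_generic T \<longleftrightarrow> (\<exists>M \<in> range (slice_B T). rank M = CARD('n))"

definition one_C_generic :: "'n::finite tensor \<Rightarrow> bool" where
  "one_C_generic T \<longleftrightarrow> (\<exists>M \<in> range (slice_C T). rank M = CARD('n))"

definition one_generic :: "'n::finite tensor \<Rightarrow> bool" where
  "one_generic T \<longleftrightarrow> one_A_generic T \<and> one_B_generic T \<and> one_C_generic T"

definition one_star_degenerate :: "'n::finite tensor \<Rightarrow> bool" where
  "one_star_degenerate T \<longleftrightarrow> \<not> one_A_generic T \<or> \<not> one_B_generic T \<or> \<not> one_C_generic T"


section \<open>Border rank\<close>

definition outer :: "complex ^ 'n \<Rightarrow> complex ^ 'n \<Rightarrow> complex ^ 'n \<Rightarrow> 'n::finite tensor" where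
  "outer a b c = (\<chi> i j k. a $ i * b $ j * c $ k)"

definition rank_one :: "'n::finite tensor \<Rightarrow> bool" where
  "rank_one t \<longleftrightarrow> (\<exists>a b c. a \<noteq> 0 \<and> b \<noteq> 0 \<and> c \<noteq> 0 \<and> t = outer a b c)"

definition rank_one_sums :: "nat \<Rightarrow> 'n::finite tensor set" where
  "rank_one_sums r = {(\<Sum>l<r. t l) | t. \<forall>l<r. rank_one (t l)}"

text \<open>Both ranks take values in \<^typ>\<open>enat\<close>, so that a minimum never degenerates to an
  unspecified number; the infimum of a nonempty set of extended naturals is attained.\<close>

definition border_rank :: "'n::finite tensor \<Rightarrow> enat" where
  "border_rank T = Inf {enat r | r. T \<in> closure (rank_one_sums r)}"


section \<open>Polynomials in several variables\<close>

text \<open>The polynomial ring over the complex numbers with one variable for each element of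
  \<open>'i\<close>: finitely supported functions on exponent vectors, with convolution product.\<close>

type_synonym 'i cpoly = "('i \<Rightarrow>\<^sub>0 nat) \<Rightarrow>\<^sub>0 complex"

definition const_poly :: "complex \<Rightarrow> 'i cpoly" where
  "const_poly c = Poly_Mapping.single 0 c"

definition mono_degree :: "('i \<Rightarrow>\<^sub>0 nat) \<Rightarrow> nat" where
  "mono_degree u = (\<Sum>i\<in>Poly_Mapping.keys u. Poly_Mapping.lookup u i)"

definition poly_value :: "'i cpoly \<Rightarrow> ('i \<Rightarrow> complex) \<Rightarrow> complex" where
  "poly_value f x = (\<Sum>u\<in>Poly_Mapping.keys f. Poly_Mapping.lookup f u *
      (\<Prod>i\<in>Poly_Mapping.keys u. x i ^ Poly_Mapping.lookup u i))"

definition homogeneous_part :: "nat \<Rightarrow> 'i cpoly \<Rightarrow> 'i cpoly" where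
  "homogeneous_part d f = (\<Sum>u\<in>{u \<in> Poly_Mapping.keys f. mono_degree u = d}.
      Poly_Mapping.single u (Poly_Mapping.lookup f u))"

definition linear_form :: "'i cpoly \<Rightarrow> bool" where
  "linear_form f \<longleftrightarrow> (\<forall>u\<in>Poly_Mapping.keys f. mono_degree u = 1)"

definition poly_ideal :: "'i cpoly set \<Rightarrow> bool" where
  "poly_ideal I \<longleftrightarrow> 0 \<in> I \<and> (\<forall>f\<in>I. \<forall>g\<in>I. f + g \<in> I) \<and> (\<forall>f. \<forall>g\<in>I. f * g \<in> I)"

definition homogeneous_ideal :: "'i cpoly set \<Rightarrow> bool" where
  "homogeneous_ideal I \<longleftrightarrow> poly_ideal I \<and> (\<forall>f\<in>I. \<forall>d. homogeneous_part d f \<in> I)"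


section \<open>Finite-dimensional commutative algebras\<close>

text \<open>
  An algebra of dimension \<open>r\<close> is given by structure constants on \<open>\<complex>\<^sup>r\<close>:
  \<open>e\<^sub>i e\<^sub>j = (\<Sum>k<r. \<mu> i j k e\<^sub>k)\<close>.  Vectors in \<open>\<complex>\<^sup>r\<close> are functions on the natural
  numbers that vanish from \<open>r\<close> on (the dimension has to vary inside the definitions below);
  values of \<open>\<mu>\<close> at indices outside the range are irrelevant.
\<close>

type_synonym structure_constants = "nat \<Rightarrow> nat \<Rightarrow> nat \<Rightarrow> complex"

definition coord_space :: "nat \<Rightarrow> (nat \<Rightarrow> complex) set" where
  "coord_space r = {x. \<forall>i\<ge>r. x i = 0}"

definition alg_mult ::
  "nat \<Rightarrow> structure_constants \<Rightarrow> (nat \<Rightarrow> complex) \<Rightarrow> (nat \<Rightarrow> complex) \<Rightarrow> nat \<Rightarrow> complex" where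
  "alg_mult r \<mu> x y =
     (\<lambda>k. if k < r then (\<Sum>i<r. \<Sum>j<r. \<mu> i j k * x i * y j) else 0)"

definition comm_algebra :: "nat \<Rightarrow> structure_constants \<Rightarrow> bool" where
  "comm_algebra r \<mu> \<longleftrightarrow>
     (\<forall>x\<in>coord_space r. \<forall>y\<in>coord_space r. alg_mult r \<mu> x y = alg_mult r \<mu> y x) \<and>
     (\<forall>x\<in>coord_space r. \<forall>y\<in>coord_space r. \<forall>z\<in>coord_space r.
        alg_mult r \<mu> (alg_mult r \<mu> x y) z = alg_mult r \<mu> x (alg_mult r \<mu> y z)) \<and>
     (\<exists>e\<in>coord_space r. \<forall>x\<in>coord_space r. alg_mult r \<mu> e x = x)"

text \<open>An isomorphism need not be required to preserve the unit, since a bijective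
  multiplicative map does so.\<close>

definition alg_isomorphic :: "nat \<Rightarrow> structure_constants \<Rightarrow> structure_constants \<Rightarrow> bool" where
  "alg_isomorphic r \<mu> \<nu> \<longleftrightarrow> (\<exists>h. bij_betw h (coord_space r) (coord_space r) \<and>
     (\<forall>x\<in>coord_space r. \<forall>y\<in>coord_space r. h (\<lambda>i. x i + y i) = (\<lambda>i. h x i + h y i)) \<and>
     (\<forall>c. \<forall>x\<in>coord_space r. h (\<lambda>i. c * x i) = (\<lambda>i. c * h x i)) \<and>
     (\<forall>x\<in>coord_space r. \<forall>y\<in>coord_space r.
        h (alg_mult r \<mu> x y) = alg_mult r \<nu> (h x) (h y)))"

text \<open>The product algebra \<open>\<complex> \<times> \<dots> \<times> \<complex>\<close>, whose spectrum consists of \<open>r\<close> reduced points.\<close>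

definition points_algebra :: structure_constants where
  "points_algebra i j k = (if i = j \<and> j = k then 1 else 0)"

definition r_reduced_points :: "nat \<Rightarrow> structure_constants \<Rightarrow> bool" where
  "r_reduced_points r \<mu> \<longleftrightarrow> alg_isomorphic r \<mu> points_algebra"


section \<open>Smoothable algebras\<close>

definition algebraic_set :: "nat \<Rightarrow> (nat \<Rightarrow> complex) set \<Rightarrow> bool" where
  "algebraic_set N V \<longleftrightarrow> (\<exists>F :: nat cpoly set. V = {s \<in> coord_space N. \<forall>f\<in>F. poly_value f s = 0})"

text \<open>
  A finite flat family of degree \<open>r\<close> over \<open>V\<close> is the spectrum of a locally free sheaf of
  algebras of rank \<open>r\<close> on \<open>V\<close>.  Being a limit is local on the base, so the base may be taken
  affine and the algebra free as a module; the family is then given by structure constants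
  that are polynomial functions on \<open>V\<close>, and its fibres are obtained by evaluating them.
\<close>

definition family_fibre :: "(nat \<Rightarrow> nat \<Rightarrow> nat \<Rightarrow> nat cpoly) \<Rightarrow> (nat \<Rightarrow> complex) \<Rightarrow> structure_constants" where
  "family_fibre M s = (\<lambda>i j k. poly_value (M i j k) s)"

definition finite_flat_family ::
  "nat \<Rightarrow> nat \<Rightarrow> (nat \<Rightarrow> complex) set \<Rightarrow> (nat \<Rightarrow> nat \<Rightarrow> nat \<Rightarrow> nat cpoly) \<Rightarrow> bool" where
  "finite_flat_family r N V M \<longleftrightarrow>
     algebraic_set N V \<and> (\<forall>s\<in>V. comm_algebra r (family_fibre M s))"

text \<open>
  The limit is taken in the classical topology of the base.  The Zariski topology gives the
  same notion, because the points whose fibre is reduced form a Zariski open subset.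
\<close>

definition smoothable :: "nat \<Rightarrow> structure_constants \<Rightarrow> bool" where
  "smoothable r \<nu> \<longleftrightarrow> (\<exists>N V M p s.
     finite_flat_family r N V M \<and>
     p \<in> V \<and> alg_isomorphic r (family_fibre M p) \<nu> \<and>
     (\<forall>n::nat. s n \<in> V \<and> r_reduced_points r (family_fibre M (s n))) \<and>
     (\<forall>i. (\<lambda>n. s n i) \<longlonglongrightarrow> p i))"


section \<open>Zero-dimensional subschemes of the Segre variety and smoothable rank\<close>

text \<open>
  \<open>quotient_algebra J r \<mu>\<close>: the quotient of the polynomial ring by \<open>J\<close> is isomorphic to
  \<open>\<complex>\<^sup>r\<close> with structure constants \<open>\<mu>\<close>; \<open>q\<close> is the quotient map.
\<close>

definition quotient_algebra :: "'i cpoly set \<Rightarrow> nat \<Rightarrow> structure_constants \<Rightarrow> bool" where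
  "quotient_algebra J r \<mu> \<longleftrightarrow> (\<exists>q :: 'i cpoly \<Rightarrow> nat \<Rightarrow> complex.
     range q = coord_space r \<and>
     (\<forall>f g. q (f + g) = (\<lambda>i. q f i + q g i)) \<and>
     (\<forall>c f. q (const_poly c * f) = (\<lambda>i. c * q f i)) \<and>
     (\<forall>f g. q (f * g) = alg_mult r \<mu> (q f) (q g)) \<and>
     {f. q f = (\<lambda>i. 0)} = J)"

text \<open>
  \<open>I\<close> is the (saturated) homogeneous ideal of a closed subscheme \<open>Spec R\<close> of projective
  space with \<open>R\<close> isomorphic to \<open>\<complex>\<^sup>r\<close> with structure constants \<open>\<mu>\<close>; in particular \<open>Spec R\<close>
  has degree \<open>r\<close>.  A zero-dimensional subscheme misses some hyperplane \<open>l = 0\<close>, which means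
  that \<open>l\<close> is not a zero divisor modulo \<open>I\<close> (and this forces \<open>I\<close> to be saturated); its
  coordinate ring in the affine chart \<open>l \<noteq> 0\<close> is the dehomogenization, the quotient by
  \<open>I + (l - 1)\<close>.
\<close>

definition zero_dim_scheme :: "'i cpoly set \<Rightarrow> nat \<Rightarrow> structure_constants \<Rightarrow> bool" where
  "zero_dim_scheme I r \<mu> \<longleftrightarrow> homogeneous_ideal I \<and>
     (\<exists>l. linear_form l \<and> (\<forall>f. l * f \<in> I \<longrightarrow> f \<in> I) \<and>
          quotient_algebra {f + g * (l - 1) | f g. f \<in> I} r \<mu>)"

text \<open>Homogeneous coordinates on \<open>\<bbbP>(A \<otimes> B \<otimes> C)\<close> are indexed by triples.\<close>

definition tensor_coords :: "'n::finite tensor \<Rightarrow> 'n \<times> 'n \<times> 'n \<Rightarrow> complex" where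
  "tensor_coords T = (\<lambda>(i, j, k). T $ i $ j $ k)"

definition segre_ideal :: "('n::finite \<times> 'n \<times> 'n) cpoly set" where
  "segre_ideal = {f. \<forall>a b c. poly_value f (tensor_coords (outer a b c)) = 0}"

definition linear_span :: "('n::finite \<times> 'n \<times> 'n) cpoly set \<Rightarrow> 'n tensor set" where
  "linear_span I = {T. \<forall>f\<in>I. linear_form f \<longrightarrow> poly_value f (tensor_coords T) = 0}"

text \<open>A subscheme lies in the Segre variety iff its ideal contains the Segre ideal.\<close>

definition smoothable_rank :: "'n::finite tensor \<Rightarrow> enat" where
  "smoothable_rank T = Inf {enat r | r. \<exists>I \<mu>. zero_dim_scheme I r \<mu> \<and> smoothable r \<mu> \<and>
      segre_ideal \<subseteq> I \<and> T \<in> linear_span I}"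

definition wild :: "'n::finite tensor \<Rightarrow> bool" where
  "wild T \<longleftrightarrow> smoothable_rank T > border_rank T"

end

theory Submission
  imports Defs "HOL-Computational_Algebra.Fundamental_Theorem_Algebra"
begin

text \<open>
  Let \<open>m = CARD('n)\<close>.  Since the border rank of \<open>T\<close> is \<open>m\<close>, the tensor is wild iff it does not lie in the
  span of a smoothable subscheme of the Segre variety of degree at most \<open>m\<close>.  So it has to be shown
  that such a scheme exists iff \<open>T\<close> is 1-generic.

  Suppose that \<open>T\<close> lies in the span of a scheme with coordinate ring \<open>R\<close> of dimension at most \<open>m\<close>.  The
  tensor coordinates become elements of \<open>R\<close> that satisfy the Segre relations, which means that, up to a
  unit, the contraction with \<open>\<alpha>\<close>, \<open>\<beta>\<close>, \<open>\<gamma>\<close> is a product \<open>a(\<alpha>) b(\<beta>) c(\<gamma>)\<close> in \<open>R\<close>; and \<open>T\<close> is obtained from it by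
  applying a linear functional on \<open>R\<close>.  Conciseness makes \<open>a\<close>, \<open>b\<close>, \<open>c\<close> injective, hence bijective, so
  there are vectors at which they are units, and the slices of \<open>T\<close> at these vectors have full rank
  (\<open>one_generic_of_scheme\<close>).  That \<open>\<alpha>\<close>, \<open>\<beta>\<close>, \<open>\<gamma>\<close> exist with invertible contraction needs the finitely many
  points of the scheme, which are provided by a Nullstellensatz for ideals of finite codimension
  (\<open>nullstellensatz_finite_codimension\<close>).

  Conversely let \<open>T\<close> be 1-generic, with invertible slices at \<open>\<alpha>0\<close>, \<open>\<beta>0\<close>, \<open>\<gamma>0\<close>, and let \<open>X n\<close> tend to \<open>T\<close> where
  each \<open>X n\<close> is a sum of \<open>m\<close> rank one tensors.  These are \<open>m\<close> points of the Segre variety, and after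
  normalization at \<open>\<alpha>0\<close>, \<open>\<beta>0\<close>, \<open>\<gamma>0\<close> their coordinate ring can be identified with the space of dual vectors
  \<open>\<alpha>\<close>.  Its structure constants, and the residue classes of all polynomials, are then obtained from the
  entries of \<open>X n\<close> by solving linear systems whose matrices are slices, so they converge even if the
  points themselves do not.  The limit is an algebra that is smoothable by construction
  (\<open>smoothable_limit\<close>), and the polynomials whose homogeneous parts have zero residue class in it form the
  ideal of a scheme of degree \<open>m\<close> that has \<open>T\<close> in its span (\<open>smoothable_rank_le_if_one_generic\<close>).  The
  scheme lies in the Segre variety because polynomials that vanish there have residue class zero for
  each \<open>n\<close>, hence in the limit.
\<close>

section \<open>Polynomials and their values\<close>

definition var :: "'i \<Rightarrow> 'i cpoly" where
  "var i = Poly_Mapping.single (Poly_Mapping.single i 1) 1"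

lemma sum_single_lookup:
  fixes f :: "'a \<Rightarrow>\<^sub>0 'b::comm_monoid_add"
  shows "(\<Sum>u\<in>Poly_Mapping.keys f. Poly_Mapping.single u (Poly_Mapping.lookup f u)) = f"
proof (rule poly_mapping_eqI)
  fix k
  show "Poly_Mapping.lookup (\<Sum>u\<in>Poly_Mapping.keys f. Poly_Mapping.single u (Poly_Mapping.lookup f u)) k
      = Poly_Mapping.lookup f k"
    by (auto simp: lookup_sum lookup_single when_def in_keys_iff)
qed

text \<open>Every polynomial is a sum of terms, so additive statements need only be checked on terms.
  The product formulas for values and homogeneous parts are obtained in this way.\<close>

lemma additive_closed_cpoly:
  assumes single: "\<And>u c. P (Poly_Mapping.single u c)"
    and add: "\<And>f g. P f \<Longrightarrow> P g \<Longrightarrow> P (f + g)"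
  shows "P (f :: 'i cpoly)"
proof -
  have "P (\<Sum>u\<in>S. Poly_Mapping.single u (Poly_Mapping.lookup f u))" if "finite S" for S
    using that
  proof (induction S)
    case empty
    show ?case using single[of 0 0] by simp
  next
    case (insert u S)
    then show ?case using add single by simp
  qed
  from this[of "Poly_Mapping.keys f"] show ?thesis by (simp add: sum_single_lookup)
qed

lemma const_poly_0 [simp]: "const_poly 0 = 0"
  and const_poly_1 [simp]: "const_poly 1 = 1"
  and const_poly_add: "const_poly (c + d) = const_poly c + const_poly d"
  and const_poly_mult: "const_poly (c * d) = const_poly c * const_poly d"
  and const_poly_uminus: "const_poly (- c) = - const_poly c"
  by (simp_all add: const_poly_def single_add mult_single single_uminus)

lemma var_power: "var i ^ n = Poly_Mapping.single (Poly_Mapping.single i n) 1"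
  by (induction n) (simp_all add: var_def mult_single flip: single_add)

lemma cpoly_induct [case_names const var add mult]:
  assumes const: "\<And>c. P (const_poly c)"
    and var: "\<And>i. P (var i)"
    and add: "\<And>f g. P f \<Longrightarrow> P g \<Longrightarrow> P (f + g)"
    and mult: "\<And>f g. P f \<Longrightarrow> P g \<Longrightarrow> P (f * g)"
  shows "P (f :: 'i cpoly)"
proof (rule additive_closed_cpoly[where P = P])
  show "P (f + g)" if "P f" "P g" for f g using that by (rule add)
next
  fix u :: "'i \<Rightarrow>\<^sub>0 nat" and c
  have power: "P (var i ^ n)" for i n
    by (induction n) (use const[of 1] var mult in auto)
  have "P (Poly_Mapping.single (\<Sum>i\<in>S. Poly_Mapping.single i (Poly_Mapping.lookup u i)) 1)"
    if "finite S" for S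
    using that
  proof (induction S)
    case empty
    show ?case using const[of 1] by simp
  next
    case (insert i S)
    then show ?case
      using mult[OF power[of i "Poly_Mapping.lookup u i"] insert.IH]
      by (simp add: var_power mult_single)
  qed
  from this[of "Poly_Mapping.keys u"] have "P (Poly_Mapping.single u 1)"
    by (simp add: sum_single_lookup)
  from mult[OF const[of c] this] show "P (Poly_Mapping.single u c)"
    by (simp add: const_poly_def mult_single)
qed

lemma additive_ext_cpoly:
  fixes \<phi> \<psi> :: "'i cpoly \<Rightarrow> 'b::ab_group_add"
  assumes "\<And>f g. \<phi> (f + g) = \<phi> f + \<phi> g" "\<And>f g. \<psi> (f + g) = \<psi> f + \<psi> g"
    and "\<And>u c. \<phi> (Poly_Mapping.single u c) = \<psi> (Poly_Mapping.single u c)"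
  shows "\<phi> f = \<psi> f"
  by (rule additive_closed_cpoly[where P = "\<lambda>f. \<phi> f = \<psi> f"]) (simp_all add: assms)

lemma poly_value_add: "poly_value (f + g) x = poly_value f x + poly_value g x"
  unfolding poly_value_def
  by (rule setsum_keys_plus_distrib) (simp_all add: distrib_right)

lemma poly_value_single:
  "poly_value (Poly_Mapping.single u c) x
    = c * (\<Prod>i\<in>Poly_Mapping.keys u. x i ^ Poly_Mapping.lookup u i)"
  by (cases "c = 0") (simp_all add: poly_value_def)

lemma prod_keys_power_add:
  fixes u v :: "'i \<Rightarrow>\<^sub>0 nat" and x :: "'i \<Rightarrow> complex"
  shows "(\<Prod>i\<in>Poly_Mapping.keys (u + v). x i ^ Poly_Mapping.lookup (u + v) i)
    = (\<Prod>i\<in>Poly_Mapping.keys u. x i ^ Poly_Mapping.lookup u i)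
      * (\<Prod>i\<in>Poly_Mapping.keys v. x i ^ Poly_Mapping.lookup v i)"
proof -
  let ?S = "Poly_Mapping.keys u \<union> Poly_Mapping.keys v"
  have *: "(\<Prod>i\<in>Poly_Mapping.keys w. x i ^ Poly_Mapping.lookup w i)
      = (\<Prod>i\<in>?S. x i ^ Poly_Mapping.lookup w i)" if "Poly_Mapping.keys w \<subseteq> ?S" for w
    by (rule prod.mono_neutral_left) (use that in \<open>auto simp: in_keys_iff\<close>)
  have "(\<Prod>i\<in>Poly_Mapping.keys (u + v). x i ^ Poly_Mapping.lookup (u + v) i)
      = (\<Prod>i\<in>?S. x i ^ Poly_Mapping.lookup (u + v) i)"
    by (rule *) (rule keys_add)
  then show ?thesis
    by (simp add: *[of u] *[of v] lookup_add power_add prod.distrib)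
qed

lemma poly_value_mult: "poly_value (f * g) x = poly_value f x * poly_value g x"
proof -
  have single: "poly_value (Poly_Mapping.single u c * g) x = poly_value (Poly_Mapping.single u c) x * poly_value g x"
    for u c
    by (rule additive_ext_cpoly[where f = g])
      (simp_all add: distrib_left poly_value_add poly_value_single mult_single prod_keys_power_add)
  show ?thesis
    by (rule additive_ext_cpoly[where f = f]) (simp_all add: distrib_right poly_value_add single)
qed

lemma poly_value_const [simp]: "poly_value (const_poly c) x = c"
  by (simp add: const_poly_def poly_value_single)

lemma poly_value_var [simp]: "poly_value (var i) x = x i"
  by (simp add: var_def poly_value_single)

lemma poly_value_0 [simp]: "poly_value 0 x = 0" and poly_value_1 [simp]: "poly_value 1 x = 1"
  using poly_value_const[of 0 x] poly_value_const[of 1 x] by simp_all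

lemma poly_value_diff: "poly_value (f - g) x = poly_value f x - poly_value g x"
  using poly_value_add[of "f - g" g x] by simp

lemma poly_value_sum: "poly_value (\<Sum>i\<in>S. f i) x = (\<Sum>i\<in>S. poly_value (f i) x)"
  by (induction S rule: infinite_finite_induct) (simp_all add: poly_value_add)

lemma tendsto_poly_value:
  assumes "\<And>i. ((\<lambda>n. x n i) \<longlongrightarrow> y i) F"
  shows "((\<lambda>n. poly_value f (x n)) \<longlongrightarrow> poly_value f y) F"
  unfolding poly_value_def by (intro tendsto_intros assms)

section \<open>Homogeneous parts and dehomogenization\<close>

lemma mono_degree_add: "mono_degree (u + v) = mono_degree u + mono_degree v"
  unfolding mono_degree_def by (rule setsum_keys_plus_distrib) simp_all

lemma lookup_homogeneous_part:
  "Poly_Mapping.lookup (homogeneous_part d f) u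
    = (if mono_degree u = d then Poly_Mapping.lookup f u else 0)"
  unfolding homogeneous_part_def
  by (auto simp: lookup_sum lookup_single when_def in_keys_iff)

lemma homogeneous_part_add:
  "homogeneous_part d (f + g) = homogeneous_part d f + homogeneous_part d g"
  by (rule poly_mapping_eqI) (simp add: lookup_homogeneous_part lookup_add)

lemma homogeneous_part_diff:
  "homogeneous_part d (f - g) = homogeneous_part d f - homogeneous_part d g"
  by (rule poly_mapping_eqI) (simp add: lookup_homogeneous_part lookup_minus)

lemma homogeneous_part_0 [simp]: "homogeneous_part d 0 = 0"
  by (rule poly_mapping_eqI) (simp add: lookup_homogeneous_part)

lemma homogeneous_part_sum:
  "homogeneous_part d (\<Sum>i\<in>S. f i) = (\<Sum>i\<in>S. homogeneous_part d (f i))"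
  by (induction S rule: infinite_finite_induct) (simp_all add: homogeneous_part_add)

lemma homogeneous_part_single:
  "homogeneous_part d (Poly_Mapping.single u c)
    = (if mono_degree u = d then Poly_Mapping.single u c else 0)"
  by (rule poly_mapping_eqI) (auto simp: lookup_homogeneous_part lookup_single when_def)

lemma homogeneous_part_homogeneous_part:
  "homogeneous_part e (homogeneous_part d f) = (if e = d then homogeneous_part d f else 0)"
  by (rule poly_mapping_eqI) (auto simp: lookup_homogeneous_part)

lemma sum_homogeneous_part:
  obtains D where "\<And>d. d \<ge> D \<Longrightarrow> homogeneous_part d f = 0"
    and "f = (\<Sum>d<D. homogeneous_part d f)"
proof -
  have "finite (mono_degree ` Poly_Mapping.keys f)" by simp
  then obtain D where "\<forall>d\<in>mono_degree ` Poly_Mapping.keys f. d < D"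
    using finite_nat_set_iff_bounded by blast
  then have small: "mono_degree u < D" if "Poly_Mapping.lookup f u \<noteq> 0" for u
    using that by (auto simp: in_keys_iff)
  show ?thesis
  proof
    show "homogeneous_part d f = 0" if "d \<ge> D" for d
    proof (rule poly_mapping_eqI)
      show "Poly_Mapping.lookup (homogeneous_part d f) u = Poly_Mapping.lookup 0 u" for u
        using small[of u] that
        by (cases "Poly_Mapping.lookup f u = 0") (auto simp: lookup_homogeneous_part)
    qed
    show "f = (\<Sum>d<D. homogeneous_part d f)"
    proof (rule poly_mapping_eqI)
      show "Poly_Mapping.lookup f u = Poly_Mapping.lookup (\<Sum>d<D. homogeneous_part d f) u" for u
        using small[of u]
        by (cases "Poly_Mapping.lookup f u = 0") (simp_all add: lookup_homogeneous_part lookup_sum)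
    qed
  qed
qed

definition homogeneous :: "nat \<Rightarrow> 'i cpoly \<Rightarrow> bool" where
  "homogeneous d f \<longleftrightarrow> homogeneous_part d f = f"

lemma homogeneous_iff: "homogeneous d f \<longleftrightarrow> (\<forall>u\<in>Poly_Mapping.keys f. mono_degree u = d)"
  unfolding homogeneous_def poly_mapping_eq_iff fun_eq_iff
  by (auto simp: lookup_homogeneous_part in_keys_iff)

lemma linear_form_iff_homogeneous: "linear_form f \<longleftrightarrow> homogeneous 1 f"
  by (simp add: linear_form_def homogeneous_iff)

lemma mono_degree_1:
  assumes "mono_degree u = 1"
  obtains i where "u = Poly_Mapping.single i 1"
proof -
  have "sum (Poly_Mapping.lookup u) (Poly_Mapping.keys u) = 1"
    using assms by (simp add: mono_degree_def)
  then obtain i where i: "i \<in> Poly_Mapping.keys u" "Poly_Mapping.lookup u i = 1"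
    and others: "\<forall>j\<in>Poly_Mapping.keys u. i \<noteq> j \<longrightarrow> Poly_Mapping.lookup u j = 0"
    unfolding sum_eq_1_iff[OF finite_keys] by blast
  have "u = Poly_Mapping.single i 1"
  proof (rule poly_mapping_eqI)
    fix j
    show "Poly_Mapping.lookup u j = Poly_Mapping.lookup (Poly_Mapping.single i 1) j"
      using i others by (cases "j = i") (auto simp: lookup_single when_def in_keys_iff)
  qed
  then show ?thesis by (rule that)
qed

lemma poly_value_linear_combination:
  assumes "linear_form f"
  shows "poly_value f (\<lambda>i. \<Sum>l\<in>S. w l * x l i) = (\<Sum>l\<in>S. w l * poly_value f (x l))"
proof -
  have "(\<Prod>i\<in>Poly_Mapping.keys u. (\<Sum>l\<in>S. w l * x l i) ^ Poly_Mapping.lookup u i)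
      = (\<Sum>l\<in>S. w l * (\<Prod>i\<in>Poly_Mapping.keys u. x l i ^ Poly_Mapping.lookup u i))"
    if "u \<in> Poly_Mapping.keys f" for u
  proof -
    have "mono_degree u = 1" using assms that unfolding linear_form_def by blast
    then obtain i where "u = Poly_Mapping.single i 1" by (rule mono_degree_1)
    then show ?thesis by simp
  qed
  then show ?thesis
    unfolding poly_value_def
    by (simp add: sum_distrib_left) (subst sum.swap, simp add: ac_simps)
qed

lemma linear_form_value_0: "linear_form f \<Longrightarrow> poly_value f (\<lambda>_. 0) = 0"
  using poly_value_linear_combination[of f _ _ "{}"] by simp

lemma homogeneous_part_is_homogeneous [simp]: "homogeneous d (homogeneous_part d f)"
  by (simp add: homogeneous_def homogeneous_part_homogeneous_part)

lemma homogeneous_part_mult: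
  assumes "homogeneous d l"
  shows "homogeneous_part (d + e) (l * f) = l * homogeneous_part e f"
proof -
  have *: "homogeneous_part (d + e) (homogeneous_part d l * f) = homogeneous_part d l * homogeneous_part e f"
    for l
  proof (rule additive_ext_cpoly[where f = l])
    fix u c
    show "homogeneous_part (d + e) (homogeneous_part d (Poly_Mapping.single u c) * f)
        = homogeneous_part d (Poly_Mapping.single u c) * homogeneous_part e f"
      by (rule additive_ext_cpoly[where f = f])
        (auto simp: distrib_left homogeneous_part_add homogeneous_part_single mult_single mono_degree_add)
  qed (simp_all add: homogeneous_part_add distrib_right)
  then show ?thesis using assms by (metis homogeneous_def)
qed

lemma homogeneous_part_mult_small:
  assumes "homogeneous d l" and "e < d"
  shows "homogeneous_part e (l * f) = 0"
proof -
  have *: "homogeneous_part e (homogeneous_part d l * f) = 0" for l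
  proof (rule additive_ext_cpoly[where f = l])
    fix u c
    show "homogeneous_part e (homogeneous_part d (Poly_Mapping.single u c) * f) = 0"
      by (rule additive_ext_cpoly[where f = f])
        (use \<open>e < d\<close> in \<open>auto simp: distrib_left homogeneous_part_add homogeneous_part_single mult_single mono_degree_add\<close>)
  qed (simp_all add: homogeneous_part_add distrib_right)
  then show ?thesis using assms by (metis homogeneous_def)
qed

lemma homogeneous_mult: "homogeneous d f \<Longrightarrow> homogeneous e g \<Longrightarrow> homogeneous (d + e) (f * g)"
  by (simp add: homogeneous_def homogeneous_part_mult)

lemma homogeneous_1: "homogeneous 0 1"
  by (simp add: homogeneous_iff mono_degree_def)

lemma homogeneous_power: "homogeneous 1 l \<Longrightarrow> homogeneous n (l ^ n)"
  by (induction n) (use homogeneous_1 homogeneous_mult[of 1 l] in auto)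

lemma homogeneous_diff: "homogeneous d f \<Longrightarrow> homogeneous d g \<Longrightarrow> homogeneous d (f - g)"
  by (simp add: homogeneous_def homogeneous_part_diff)

lemma linear_form_diff: "linear_form f \<Longrightarrow> linear_form g \<Longrightarrow> linear_form (f - g)"
  by (simp add: linear_form_iff_homogeneous homogeneous_diff)

lemma homogeneous_sum: "(\<And>i. i \<in> S \<Longrightarrow> homogeneous d (f i)) \<Longrightarrow> homogeneous d (\<Sum>i\<in>S. f i)"
  by (simp add: homogeneous_def homogeneous_part_sum)

lemma homogeneous_const: "homogeneous 0 (const_poly c)"
  by (cases "c = 0") (simp_all add: homogeneous_iff const_poly_def mono_degree_def)

lemma homogeneous_var: "homogeneous 1 (var i)"
  by (simp add: homogeneous_iff var_def mono_degree_def)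

lemma ideal_diff: "poly_ideal I \<Longrightarrow> f \<in> I \<Longrightarrow> g \<in> I \<Longrightarrow> f - g \<in> I"
proof -
  assume I: "poly_ideal I" and "f \<in> I" "g \<in> I"
  then have "f + (- 1) * g \<in> I" unfolding poly_ideal_def by blast
  then show ?thesis by simp
qed

text \<open>A linear form that vanishes on the affine part of the scheme vanishes on the scheme.  Comparing
  degrees in \<open>f = h + g (l - 1)\<close> shows that modulo \<open>I\<close> the part of \<open>g\<close> of degree \<open>d + 1\<close> is
  \<open>l\<close> times that of degree \<open>d\<close> for \<open>d \<ge> 1\<close>.  These parts are eventually zero, and \<open>l\<close> can be
  cancelled modulo \<open>I\<close>, so they all lie in \<open>I\<close>; then so does \<open>f\<close>, which is minus the linear part
  of \<open>g\<close> modulo \<open>I\<close>.\<close>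

lemma linear_form_dehomogenization:
  assumes I: "homogeneous_ideal I" and l: "linear_form l" and nzd: "\<And>f. l * f \<in> I \<Longrightarrow> f \<in> I"
    and f: "linear_form f" and h: "h \<in> I" and eq: "f = h + g * (l - 1)"
  shows "f \<in> I"
proof -
  have idl: "poly_ideal I" and hp: "\<And>f d. f \<in> I \<Longrightarrow> homogeneous_part d f \<in> I"
    using I by (auto simp: homogeneous_ideal_def)
  have idm: "\<And>f g. g \<in> I \<Longrightarrow> f * g \<in> I" using idl by (auto simp: poly_ideal_def)
  have l1: "homogeneous 1 l" and f1: "homogeneous 1 f"
    using l f by (simp_all add: linear_form_iff_homogeneous)
  let ?g = "\<lambda>d. homogeneous_part d g"
  have eq': "l * g - g = f - h" using eq by (simp add: algebra_simps)
  have step: "l * ?g d - ?g (Suc d) = homogeneous_part (Suc d) f - homogeneous_part (Suc d) h" for d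
    using arg_cong[OF eq', of "homogeneous_part (Suc d)"] homogeneous_part_mult[OF l1, of d g]
    by (simp add: homogeneous_part_diff)
  have f_part: "homogeneous_part d f = (if d = 1 then f else 0)" for d
    using f1 by (metis homogeneous_def homogeneous_part_homogeneous_part)
  have "?g 0 = homogeneous_part 0 h"
    using arg_cong[OF eq', of "homogeneous_part 0"] homogeneous_part_mult_small[OF l1, of 0 g] f_part
    by (simp add: homogeneous_part_diff)
  then have g0: "?g 0 \<in> I" using hp[OF h] by simp
  have down: "?g (Suc d) \<in> I" if "?g (Suc (Suc d)) \<in> I" for d
  proof (rule nzd)
    have "l * ?g (Suc d) = ?g (Suc (Suc d)) - homogeneous_part (Suc (Suc d)) h"
      using step[of "Suc d"] f_part[of "Suc (Suc d)"] by (simp add: algebra_simps)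
    then show "l * ?g (Suc d) \<in> I" using ideal_diff[OF idl that hp[OF h]] by simp
  qed
  obtain D where D: "\<And>d. d \<ge> D \<Longrightarrow> ?g d = 0" using sum_homogeneous_part[of g] by metis
  have zero: "0 \<in> I" using idl by (simp add: poly_ideal_def)
  have "?g 1 \<in> I"
  proof (rule inc_induct[of 1 "Suc D" "\<lambda>d. ?g d \<in> I"])
    show "?g (Suc D) \<in> I" using D zero by simp
    show "?g d \<in> I" if "1 \<le> d" "?g (Suc d) \<in> I" for d
      using that down[of "d - 1"] by simp
  qed simp
  moreover have "f = l * ?g 0 - ?g 1 + homogeneous_part 1 h"
    using step[of 0] f_part[of 1] by (simp add: algebra_simps)
  ultimately show "f \<in> I"
    using idm[OF g0, of l] hp[OF h, of 1] ideal_diff[OF idl] idl by (simp add: poly_ideal_def)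
qed

section \<open>Contractions of tensors as linear forms on the Segre variety\<close>

definition trilinear ::
  "('n::finite \<times> 'n \<times> 'n \<Rightarrow> complex) \<Rightarrow> complex ^ 'n \<Rightarrow> complex ^ 'n \<Rightarrow> complex ^ 'n \<Rightarrow> complex" where
  "trilinear x \<alpha> \<beta> \<gamma> = (\<Sum>i\<in>UNIV. \<Sum>j\<in>UNIV. \<Sum>k\<in>UNIV. \<alpha> $ i * \<beta> $ j * \<gamma> $ k * x (i, j, k))"

text \<open>The contraction of a tensor with three dual vectors, as a linear form in the coordinates of the
  tensor.\<close>

definition segre_form ::
  "complex ^ 'n::finite \<Rightarrow> complex ^ 'n \<Rightarrow> complex ^ 'n \<Rightarrow> ('n \<times> 'n \<times> 'n) cpoly" where
  "segre_form \<alpha> \<beta> \<gamma>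
    = (\<Sum>i\<in>UNIV. \<Sum>j\<in>UNIV. \<Sum>k\<in>UNIV. const_poly (\<alpha> $ i * \<beta> $ j * \<gamma> $ k) * var (i, j, k))"

lemma poly_value_segre_form [simp]: "poly_value (segre_form \<alpha> \<beta> \<gamma>) x = trilinear x \<alpha> \<beta> \<gamma>"
  by (simp add: segre_form_def trilinear_def poly_value_sum poly_value_mult)

lemma linear_form_segre_form: "linear_form (segre_form \<alpha> \<beta> \<gamma>)"
  unfolding segre_form_def linear_form_iff_homogeneous
  using homogeneous_mult[OF homogeneous_const homogeneous_var] by (intro homogeneous_sum) simp

lemma trilinear_outer:
  "trilinear (tensor_coords (outer a b c)) \<alpha> \<beta> \<gamma>
    = (\<Sum>i\<in>UNIV. \<alpha> $ i * a $ i) * (\<Sum>j\<in>UNIV. \<beta> $ j * b $ j) * (\<Sum>k\<in>UNIV. \<gamma> $ k * c $ k)"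
  unfolding trilinear_def tensor_coords_def outer_def
  by (simp add: sum_product sum_distrib_left sum_distrib_right ac_simps)
    (simp add: sum_distrib_left[symmetric] sum.swap ac_simps)

text \<open>Exchanging one argument between two contractions does not change their product on rank one tensors;
  the resulting quadrics are combinations of the \<open>2 \<times> 2\<close> minors of the flattenings.\<close>

lemma segre_swap:
  shows segre_swap_A: "segre_form \<alpha> \<beta> \<gamma> * segre_form \<alpha>' \<beta>' \<gamma>'
      - segre_form \<alpha>' \<beta> \<gamma> * segre_form \<alpha> \<beta>' \<gamma>' \<in> segre_ideal"
    and segre_swap_B: "segre_form \<alpha> \<beta> \<gamma> * segre_form \<alpha>' \<beta>' \<gamma>'
      - segre_form \<alpha> \<beta>' \<gamma> * segre_form \<alpha>' \<beta> \<gamma>' \<in> segre_ideal"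
    and segre_swap_C: "segre_form \<alpha> \<beta> \<gamma> * segre_form \<alpha>' \<beta>' \<gamma>'
      - segre_form \<alpha> \<beta> \<gamma>' * segre_form \<alpha>' \<beta>' \<gamma> \<in> segre_ideal"
  by (simp_all add: segre_ideal_def poly_value_diff poly_value_mult trilinear_outer)

lemma trilinear_swap_sums:
  "trilinear x \<alpha> \<beta> \<gamma> = (\<Sum>k\<in>UNIV. \<gamma> $ k * (\<Sum>j\<in>UNIV. \<beta> $ j * (\<Sum>i\<in>UNIV. \<alpha> $ i * x (i, j, k))))"
proof -
  have "trilinear x \<alpha> \<beta> \<gamma>
    = (\<Sum>j\<in>UNIV. \<Sum>i\<in>UNIV. \<Sum>k\<in>UNIV. \<alpha> $ i * \<beta> $ j * \<gamma> $ k * x (i, j, k))"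
    unfolding trilinear_def by (rule sum.swap)
  also have "\<dots> = (\<Sum>j\<in>UNIV. \<Sum>k\<in>UNIV. \<Sum>i\<in>UNIV. \<alpha> $ i * \<beta> $ j * \<gamma> $ k * x (i, j, k))"
    by (intro sum.cong refl sum.swap)
  also have "\<dots> = (\<Sum>k\<in>UNIV. \<Sum>j\<in>UNIV. \<Sum>i\<in>UNIV. \<alpha> $ i * \<beta> $ j * \<gamma> $ k * x (i, j, k))"
    by (rule sum.swap)
  finally show ?thesis by (simp add: sum_distrib_left ac_simps)
qed

lemma trilinear_slice_A:
  "trilinear (tensor_coords T) \<alpha> \<beta> \<gamma> = (\<Sum>j\<in>UNIV. \<Sum>k\<in>UNIV. \<beta> $ j * \<gamma> $ k * slice_A T \<alpha> $ j $ k)"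
  unfolding trilinear_def tensor_coords_def slice_A_def
  by (subst sum.swap, rule sum.cong[OF refl], subst sum.swap)
    (simp add: sum_distrib_left ac_simps)

lemma trilinear_slice_B:
  "trilinear (tensor_coords T) \<alpha> \<beta> \<gamma> = (\<Sum>i\<in>UNIV. \<Sum>k\<in>UNIV. \<alpha> $ i * \<gamma> $ k * slice_B T \<beta> $ i $ k)"
  unfolding trilinear_def tensor_coords_def slice_B_def
  by (rule sum.cong[OF refl], subst sum.swap) (simp add: sum_distrib_left ac_simps)

lemma trilinear_slice_C:
  "trilinear (tensor_coords T) \<alpha> \<beta> \<gamma> = (\<Sum>i\<in>UNIV. \<Sum>j\<in>UNIV. \<alpha> $ i * \<beta> $ j * slice_C T \<gamma> $ i $ j)"
  unfolding trilinear_def tensor_coords_def slice_C_def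
  by (simp add: sum_distrib_left ac_simps)

lemma segre_form_add:
  shows segre_form_add_A: "segre_form (\<alpha> + \<alpha>') \<beta> \<gamma> = segre_form \<alpha> \<beta> \<gamma> + segre_form \<alpha>' \<beta> \<gamma>"
    and segre_form_add_B: "segre_form \<alpha> (\<beta> + \<beta>') \<gamma> = segre_form \<alpha> \<beta> \<gamma> + segre_form \<alpha> \<beta>' \<gamma>"
  by (simp_all add: segre_form_def const_poly_add sum.distrib algebra_simps)

lemma segre_form_scale:
  shows segre_form_scale_A: "segre_form (c *s \<alpha>) \<beta> \<gamma> = const_poly c * segre_form \<alpha> \<beta> \<gamma>"
    and segre_form_scale_B: "segre_form \<alpha> (c *s \<beta>) \<gamma> = const_poly c * segre_form \<alpha> \<beta> \<gamma>"
  by (simp_all add: segre_form_def const_poly_mult sum_distrib_left ac_simps)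

lemma sum_axis:
  fixes h :: "'n::finite \<Rightarrow> complex"
  shows "(\<Sum>i\<in>UNIV. axis j t $ i * h i) = t * h j"
  by (simp add: axis_def if_distrib if_distribR cong: if_cong)

lemma bilinear_axis:
  fixes M :: "complex ^ 'n::finite ^ 'n"
  shows "(\<Sum>j\<in>UNIV. \<Sum>k\<in>UNIV. axis j' 1 $ j * v $ k * M $ j $ k) = (M *v v) $ j'"
    and "(\<Sum>j\<in>UNIV. \<Sum>k\<in>UNIV. v $ j * axis k' 1 $ k * M $ j $ k) = (transpose M *v v) $ k'"
proof -
  have "(\<Sum>j\<in>UNIV. \<Sum>k\<in>UNIV. axis j' 1 $ j * v $ k * M $ j $ k)
      = (\<Sum>j\<in>UNIV. axis j' 1 $ j * (\<Sum>k\<in>UNIV. v $ k * M $ j $ k))"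
    by (simp add: sum_distrib_left mult.assoc)
  then show "(\<Sum>j\<in>UNIV. \<Sum>k\<in>UNIV. axis j' 1 $ j * v $ k * M $ j $ k) = (M *v v) $ j'"
    by (simp add: sum_axis matrix_vector_mult_def mult.commute)
  have "(\<Sum>j\<in>UNIV. \<Sum>k\<in>UNIV. v $ j * axis k' 1 $ k * M $ j $ k)
      = (\<Sum>j\<in>UNIV. \<Sum>k\<in>UNIV. axis k' 1 $ k * (v $ j * M $ j $ k))"
    by (simp add: ac_simps)
  then show "(\<Sum>j\<in>UNIV. \<Sum>k\<in>UNIV. v $ j * axis k' 1 $ k * M $ j $ k) = (transpose M *v v) $ k'"
    by (simp add: sum_axis matrix_vector_mult_def transpose_def mult.commute)
qed

lemma concise_trilinear:
  assumes "concise T"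
  shows "(\<And>\<beta> \<gamma>. trilinear (tensor_coords T) \<alpha> \<beta> \<gamma> = 0) \<Longrightarrow> \<alpha> = 0"
    and "(\<And>\<alpha> \<gamma>. trilinear (tensor_coords T) \<alpha> \<beta> \<gamma> = 0) \<Longrightarrow> \<beta> = 0"
    and "(\<And>\<alpha> \<beta>. trilinear (tensor_coords T) \<alpha> \<beta> \<gamma> = 0) \<Longrightarrow> \<gamma> = 0"
proof -
  have bil: "M = 0" if "\<And>v w. (\<Sum>j\<in>UNIV. \<Sum>k\<in>UNIV. v $ j * w $ k * M $ j $ k) = 0"
    for M :: "complex ^ 'n ^ 'n"
  proof -
    have "(M *v w) $ j = 0" for w j using that[of "axis j 1" w] by (simp add: bilinear_axis)
    then have "M *v w = 0 *v w" for w by (simp add: vec_eq_iff)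
    then show ?thesis unfolding matrix_eq by blast
  qed
  show "\<alpha> = 0" if "\<And>\<beta> \<gamma>. trilinear (tensor_coords T) \<alpha> \<beta> \<gamma> = 0"
  proof -
    have "slice_A T \<alpha> = slice_A T 0"
      using bil[of "slice_A T \<alpha>"] that by (simp add: trilinear_slice_A) (simp add: slice_A_def vec_eq_iff)
    then show ?thesis using assms by (simp add: concise_def inj_eq)
  qed
  show "\<beta> = 0" if "\<And>\<alpha> \<gamma>. trilinear (tensor_coords T) \<alpha> \<beta> \<gamma> = 0"
  proof -
    have "slice_B T \<beta> = slice_B T 0"
      using bil[of "slice_B T \<beta>"] that by (simp add: trilinear_slice_B) (simp add: slice_B_def vec_eq_iff)
    then show ?thesis using assms by (simp add: concise_def inj_eq)
  qed
  show "\<gamma> = 0" if "\<And>\<alpha> \<beta>. trilinear (tensor_coords T) \<alpha> \<beta> \<gamma> = 0"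
  proof -
    have "slice_C T \<gamma> = slice_C T 0"
      using bil[of "slice_C T \<gamma>"] that by (simp add: trilinear_slice_C) (simp add: slice_C_def vec_eq_iff)
    then show ?thesis using assms by (simp add: concise_def inj_eq)
  qed
qed

section \<open>Rank and determinant of square matrices\<close>

lemma full_rank_iff_det:
  fixes M :: "complex ^ 'n ^ 'n::finite"
  shows "rank M = CARD('n) \<longleftrightarrow> det M \<noteq> 0"
proof -
  have "rank M = CARD('n) \<longleftrightarrow> vec.span (rows M) = UNIV"
    using vec.dim_eq_full[of "rows M"] by (simp add: row_rank_def_gen vec.dimension_def card_cart_basis)
  also have "\<dots> \<longleftrightarrow> invertible M"
    by (simp add: matrix_left_invertible_span_rows_gen[symmetric] invertible_left_inverse)
  finally show ?thesis by (simp add: invertible_det_nz)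
qed

lemma det_nonzero_iff_kernel:
  fixes M :: "complex ^ 'n ^ 'n::finite"
  shows "det M \<noteq> 0 \<longleftrightarrow> (\<forall>v. M *v v = 0 \<longrightarrow> v = 0)"
  by (simp add: invertible_det_nz[symmetric] invertible_left_inverse matrix_left_invertible_ker)

section \<open>Zeros of ideals of finite codimension\<close>

text \<open>Substitution of a multivariate polynomial for the variable of a univariate one.\<close>

definition eval_poly :: "complex poly \<Rightarrow> 'i cpoly \<Rightarrow> 'i cpoly" where
  "eval_poly p f = poly (map_poly const_poly p) f"

lemma eval_poly_0 [simp]: "eval_poly 0 f = 0"
  and eval_poly_pCons: "eval_poly (pCons a p) f = const_poly a + f * eval_poly p f"
  by (simp_all add: eval_poly_def map_poly_pCons)

lemma eval_poly_add: "eval_poly (p + q) f = eval_poly p f + eval_poly q f"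
  by (induction p q rule: poly_induct2) (simp_all add: eval_poly_pCons const_poly_add algebra_simps)

lemma eval_poly_smult: "eval_poly (smult c p) f = const_poly c * eval_poly p f"
  by (induction p) (simp_all add: eval_poly_pCons const_poly_mult algebra_simps)

lemma eval_poly_mult: "eval_poly (p * q) f = eval_poly p f * eval_poly q f"
  by (induction p) (simp_all add: eval_poly_pCons eval_poly_add eval_poly_smult algebra_simps)

lemma eval_poly_monom: "eval_poly (monom c n) f = const_poly c * f ^ n"
  by (induction n) (simp_all add: eval_poly_pCons monom_0 monom_Suc)

lemma eval_poly_sum: "eval_poly (\<Sum>i\<in>S. p i) f = (\<Sum>i\<in>S. eval_poly (p i) f)"
  by (induction S rule: infinite_finite_induct) (simp_all add: eval_poly_add)

lemma poly_value_eval_poly: "poly_value (eval_poly p f) x = poly p (poly_value f x)"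
  by (induction p) (simp_all add: eval_poly_pCons poly_value_add poly_value_mult)

lemma ideal_adjoin:
  assumes I: "poly_ideal I"
  shows ideal_adjoin_ideal: "poly_ideal {k + h * f | k h. k \<in> I}" (is "poly_ideal ?L")
    and ideal_adjoin_subset: "I \<subseteq> {k + h * f | k h. k \<in> I}"
    and ideal_adjoin_mem: "f \<in> {k + h * f | k h. k \<in> I}"
proof -
  have zero: "0 \<in> I" and add: "\<And>a b. a \<in> I \<Longrightarrow> b \<in> I \<Longrightarrow> a + b \<in> I"
    and mult: "\<And>a b. b \<in> I \<Longrightarrow> a * b \<in> I"
    using I by (auto simp: poly_ideal_def)
  show subset: "I \<subseteq> ?L"
  proof
    fix k assume "k \<in> I"
    moreover have "k = k + 0 * f" by simp
    ultimately show "k \<in> ?L" by blast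
  qed
  have "f = 0 + 1 * f" by simp
  then show "f \<in> ?L" using zero by blast
  show "poly_ideal ?L"
    unfolding poly_ideal_def
  proof (intro conjI ballI allI)
    show "0 \<in> ?L" using zero subset by blast
    fix a b assume "a \<in> ?L"
    then obtain k h where a: "a = k + h * f" "k \<in> I" by blast
    have "b * a = b * k + (b * h) * f" by (simp add: a(1) distrib_left mult.assoc)
    then show "b * a \<in> ?L" using mult[OF a(2)] by blast
    assume "b \<in> ?L"
    then obtain k' h' where b: "b = k' + h' * f" "k' \<in> I" by blast
    have "a + b = (k + k') + (h + h') * f" by (simp add: a(1) b(1) algebra_simps)
    then show "a + b \<in> ?L" using add[OF a(2) b(2)] by blast
  qed
qed

lemma maximal_ideal_prime:
  assumes K: "poly_ideal K" and proper: "1 \<notin> K"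
    and max: "\<And>L. poly_ideal L \<Longrightarrow> K \<subseteq> L \<Longrightarrow> 1 \<notin> L \<Longrightarrow> L = K"
    and fg: "f * g \<in> K"
  shows "f \<in> K \<or> g \<in> K"
proof (rule ccontr)
  assume not: "\<not> (f \<in> K \<or> g \<in> K)"
  define L where "L = {k + h * f | k h. k \<in> K}"
  have "poly_ideal L" "K \<subseteq> L" "f \<in> L"
    unfolding L_def using ideal_adjoin[OF K] by blast+
  then have "1 \<in> L" using max[of L] not by blast
  then obtain k h where "1 = k + h * f" "k \<in> K" unfolding L_def by blast
  then have "g = g * k + h * (f * g)" by (metis mult.left_commute mult.commute mult.right_neutral distrib_left)
  moreover have "g * k + h * (f * g) \<in> K" using K \<open>k \<in> K\<close> fg by (auto simp: poly_ideal_def)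
  ultimately show False using not by simp
qed

lemma const_in_ideal:
  assumes "poly_ideal K" "const_poly c \<in> K" "1 \<notin> K"
  shows "c = 0"
proof (rule ccontr)
  assume "c \<noteq> 0"
  then have "1 = const_poly (inverse c) * const_poly c" by (simp flip: const_poly_mult)
  then show False using assms unfolding poly_ideal_def by metis
qed

text \<open>Over the complex numbers a univariate polynomial splits into linear factors, and a prime ideal that
  contains a product contains a factor.\<close>

lemma root_in_prime_ideal:
  assumes K: "poly_ideal K" and proper: "1 \<notin> K"
    and prime: "\<And>f g. f * g \<in> K \<Longrightarrow> f \<in> K \<or> g \<in> K"
    and "p \<noteq> 0" "eval_poly p f \<in> K"
  shows "\<exists>c. f - const_poly c \<in> K"
  using assms(4,5)
proof (induction "degree p" arbitrary: p rule: less_induct)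
  case less
  show ?case
  proof (cases "degree p = 0")
    case True
    then obtain a where "p = [:a:]" by (metis degree_eq_zeroE)
    then show ?thesis using less.prems const_in_ideal[OF K _ proper, of a]
      by (simp add: eval_poly_pCons)
  next
    case False
    then obtain c where "poly p c = 0"
      using fundamental_theorem_of_algebra[of p] by (auto simp: constant_degree)
    then obtain p' where p': "p = [:- c, 1:] * p'" by (metis poly_eq_0_iff_dvd dvdE)
    with less.prems have "p' \<noteq> 0" by auto
    then have deg: "degree p' < degree p" unfolding p' by (subst degree_mult_eq) simp_all
    have "(f - const_poly c) * eval_poly p' f \<in> K"
      using less.prems(2) unfolding p'
      by (simp only: eval_poly_mult) (simp add: eval_poly_pCons const_poly_uminus)
    then show ?thesis using prime less.hyps[OF deg \<open>p' \<noteq> 0\<close>] by blast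
  qed
qed

text \<open>The weak Nullstellensatz is elementary when every polynomial is algebraic modulo \<open>K\<close>: in a maximal
  proper ideal above \<open>K\<close> each variable is congruent to a constant, and these constants are the
  coordinates of a common zero.\<close>

lemma nullstellensatz_finite_codimension:
  fixes K :: "'i cpoly set"
  assumes K: "poly_ideal K" and proper: "1 \<notin> K"
    and integral: "\<And>f. \<exists>p. p \<noteq> 0 \<and> eval_poly p f \<in> K"
  shows "\<exists>x. \<forall>f\<in>K. poly_value f x = 0"
proof -
  let ?A = "{L. poly_ideal L \<and> K \<subseteq> L \<and> 1 \<notin> L}"
  have "\<exists>M\<in>?A. \<forall>X\<in>?A. M \<subseteq> X \<longrightarrow> X = M"
  proof (rule subset_Zorn_nonempty)
    show "?A \<noteq> {}" using K proper by blast
    fix C assume ne: "C \<noteq> {}" and chain: "subset.chain ?A C"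
    have sub: "C \<subseteq> ?A" and lin: "\<And>X Y. X \<in> C \<Longrightarrow> Y \<in> C \<Longrightarrow> X \<subseteq> Y \<or> Y \<subseteq> X"
      using chain by (auto simp: subset_chain_def)
    have ideal: "poly_ideal X" if "X \<in> C" for X using sub that by blast
    have "poly_ideal (\<Union>C)"
      unfolding poly_ideal_def
    proof (intro conjI ballI allI)
      show "0 \<in> \<Union>C" using ne ideal by (auto simp: poly_ideal_def)
      fix f g assume "f \<in> \<Union>C"
      then obtain X where X: "X \<in> C" "f \<in> X" by blast
      then have "g * f \<in> X" using ideal by (simp add: poly_ideal_def)
      then show "g * f \<in> \<Union>C" using X by blast
      assume "g \<in> \<Union>C"
      then obtain Y where Y: "Y \<in> C" "g \<in> Y" by blast
      consider "f \<in> Y" | "g \<in> X" using lin[OF X(1) Y(1)] X(2) Y(2) by blast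
      then show "f + g \<in> \<Union>C"
      proof cases
        case 1
        then have "f + g \<in> Y" using ideal[OF Y(1)] Y(2) by (simp add: poly_ideal_def)
        then show ?thesis using Y(1) by blast
      next
        case 2
        then have "f + g \<in> X" using ideal[OF X(1)] X(2) by (simp add: poly_ideal_def)
        then show ?thesis using X(1) by blast
      qed
    qed
    then show "\<Union>C \<in> ?A" using ne sub by blast
  qed
  then obtain M where M: "poly_ideal M" "K \<subseteq> M" "1 \<notin> M"
    and max: "\<And>X. poly_ideal X \<Longrightarrow> K \<subseteq> X \<Longrightarrow> 1 \<notin> X \<Longrightarrow> M \<subseteq> X \<Longrightarrow> X = M"
    by auto
  have prime: "f \<in> M \<or> g \<in> M" if "f * g \<in> M" for f g
    using maximal_ideal_prime[OF M(1,3) _ that] max M(2) by blast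
  have "\<exists>c. var i - const_poly c \<in> M" for i
  proof -
    obtain p where "p \<noteq> 0" "eval_poly p (var i) \<in> K" using integral by blast
    then show ?thesis using root_in_prime_ideal[OF M(1,3) prime] M(2) by blast
  qed
  then obtain x where x: "\<And>i. var i - const_poly (x i) \<in> M" by metis
  have add: "\<And>f g. f \<in> M \<Longrightarrow> g \<in> M \<Longrightarrow> f + g \<in> M" and mult: "\<And>f g. g \<in> M \<Longrightarrow> f * g \<in> M"
    and zero: "0 \<in> M"
    using M(1) by (auto simp: poly_ideal_def)
  \<comment> \<open>Modulo the maximal ideal every polynomial is its value at the point found.\<close>
  have reduce: "f - const_poly (poly_value f x) \<in> M" for f
  proof (induction f rule: cpoly_induct)
    case (const c)
    then show ?case using zero by simp
  next
    case (var i)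
    then show ?case using x by simp
  next
    case (add f g)
    have "f + g - const_poly (poly_value (f + g) x)
        = (f - const_poly (poly_value f x)) + (g - const_poly (poly_value g x))"
      by (simp add: poly_value_add const_poly_add)
    then show ?case using \<open>\<And>f g. f \<in> M \<Longrightarrow> g \<in> M \<Longrightarrow> f + g \<in> M\<close> add by metis
  next
    case (mult f g)
    have "f * g - const_poly (poly_value (f * g) x)
        = g * (f - const_poly (poly_value f x)) + const_poly (poly_value f x) * (g - const_poly (poly_value g x))"
      by (simp add: poly_value_mult const_poly_mult algebra_simps)
    then show ?case
      using mult.IH add[OF \<open>\<And>f g. g \<in> M \<Longrightarrow> f * g \<in> M\<close> \<open>\<And>f g. g \<in> M \<Longrightarrow> f * g \<in> M\<close>] by metis
  qed
  have "poly_value f x = 0" if "f \<in> K" for f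
  proof -
    have "f - (f - const_poly (poly_value f x)) \<in> M"
      using ideal_diff[OF M(1) _ reduce] M(2) that by blast
    then show ?thesis using const_in_ideal[OF M(1) _ M(3)] by simp
  qed
  then show ?thesis by blast
qed

text \<open>Here \<open>Q\<close> presents a quotient of dimension at most \<open>CARD('n)\<close>, so the first \<open>CARD('n) + 1\<close> powers of
  \<open>f\<close> are linearly dependent modulo \<open>J\<close>.\<close>

lemma integral_of_finite_codimension:
  fixes Q :: "'i cpoly \<Rightarrow> complex ^ 'n::finite"
  assumes add: "\<And>f g. Q (f + g) = Q f + Q g" and scale: "\<And>c f. Q (const_poly c * f) = c *s Q f"
    and ker: "\<And>f. Q f = 0 \<Longrightarrow> f \<in> J"
  shows "\<exists>p. p \<noteq> 0 \<and> eval_poly p f \<in> J"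
proof -
  have Q0: "Q 0 = 0" using add[of 0 0] by simp
  have Qsum: "Q (\<Sum>i\<in>S. h i) = (\<Sum>i\<in>S. Q (h i))" for S and h :: "nat \<Rightarrow> 'i cpoly"
    by (induction S rule: infinite_finite_induct) (simp_all add: Q0 add)
  let ?m = "CARD('n)"
  have "\<exists>c. (\<exists>i\<le>?m. c i \<noteq> 0) \<and> (\<Sum>i\<le>?m. c i *s Q (f ^ i)) = 0"
  proof (cases "inj_on (\<lambda>i. Q (f ^ i)) {..?m}")
    case True
    let ?S = "(\<lambda>i. Q (f ^ i)) ` {..?m}"
    have "card ?S = Suc ?m" using card_image[OF True] by simp
    moreover have "vec.dim ?S \<le> ?m"
      using vec.dim_subset_UNIV[of ?S] by (simp add: vec.dimension_def card_cart_basis)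
    ultimately have "vec.dependent ?S" by (intro vec.dependent_biggerset_general) auto
    then obtain u where u: "\<exists>v\<in>?S. u v \<noteq> 0" "(\<Sum>v\<in>?S. u v *s v) = 0"
      by (auto simp: vec.dependent_finite)
    show ?thesis
      by (rule exI[of _ "\<lambda>i. u (Q (f ^ i))"]) (use u in \<open>auto simp: sum.reindex[OF True]\<close>)
  next
    case False
    then obtain i j where ij: "i \<le> ?m" "j \<le> ?m" "i \<noteq> j" "Q (f ^ i) = Q (f ^ j)"
      by (auto simp: inj_on_def)
    \<comment> \<open>Two powers with the same residue class are dependent as a family, although not as a set.\<close>
    let ?c = "\<lambda>k. if k = i then 1 else if k = j then - 1 else (0::complex)"
    have "(\<Sum>k\<le>?m. ?c k *s Q (f ^ k)) = (\<Sum>k\<in>{i, j}. ?c k *s Q (f ^ k))"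
      by (rule sum.mono_neutral_right) (use ij in auto)
    also have "\<dots> = 0" using ij by simp
    finally show ?thesis using ij by (intro exI[of _ ?c]) auto
  qed
  then obtain c i where c: "i \<le> ?m" "c i \<noteq> 0" "(\<Sum>i\<le>?m. c i *s Q (f ^ i)) = 0" by blast
  define p where "p = (\<Sum>i\<le>?m. monom (c i) i)"
  have "coeff p i \<noteq> 0" using c by (simp add: p_def coeff_sum sum.delta)
  then have "p \<noteq> 0" by auto
  moreover have "Q (eval_poly p f) = 0"
    using c(3) by (simp add: p_def eval_poly_sum eval_poly_monom Qsum scale)
  ultimately show ?thesis using ker by blast
qed

lemma finite_zeros:
  fixes J :: "'i::finite cpoly set"
  assumes integral: "\<And>f. \<exists>p. p \<noteq> 0 \<and> eval_poly p f \<in> J"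
  shows "finite {x. \<forall>f\<in>J. poly_value f x = 0}"
proof -
  have "\<forall>i. \<exists>p. p \<noteq> 0 \<and> eval_poly p (var i) \<in> J" by (intro allI integral)
  from choice[OF this] obtain p
    where p: "\<And>i. p i \<noteq> 0" "\<And>i. eval_poly (p i) (var i) \<in> J" by auto
  have "x i \<in> {c. poly (p i) c = 0}" if "\<forall>f\<in>J. poly_value f x = 0" for x i
    using that p(2)[of i] poly_value_eval_poly[of "p i" "var i" x] by simp
  then have "{x. \<forall>f\<in>J. poly_value f x = 0} \<subseteq> (\<Pi>\<^sub>E i\<in>UNIV. {c. poly (p i) c = 0})"
    by auto
  then show ?thesis
    by (rule finite_subset) (intro finite_PiE poly_roots_finite p(1) finite)
qed

section \<open>A linear form that vanishes at no point of a finite scheme\<close>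

text \<open>A space over an infinite field is not a finite union of hyperplanes.\<close>

lemma ex_nonvanishing_vector:
  fixes S :: "(complex ^ 'n::finite) set"
  assumes "finite S" "0 \<notin> S"
  shows "\<exists>\<alpha>. \<forall>v\<in>S. (\<Sum>i\<in>UNIV. \<alpha> $ i * v $ i) \<noteq> 0"
  using assms
proof (induction S)
  case empty
  then show ?case by simp
next
  case (insert v S)
  then obtain \<alpha> where \<alpha>: "\<And>w. w \<in> S \<Longrightarrow> (\<Sum>i\<in>UNIV. \<alpha> $ i * w $ i) \<noteq> 0" by auto
  obtain j where j: "v $ j \<noteq> 0" using insert.prems by (auto simp: vec_eq_iff)
  let ?p = "\<lambda>w. [:\<Sum>i\<in>UNIV. \<alpha> $ i * w $ i, w $ j:]"
  have "finite (\<Union>w\<in>insert v S. {t. poly (?p w) t = 0})"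
  proof (intro finite_UN_I poly_roots_finite)
    show "?p w \<noteq> 0" if "w \<in> insert v S" for w using that \<alpha> j by auto
  qed (use insert.hyps(1) in simp)
  then obtain t where t: "t \<notin> (\<Union>w\<in>insert v S. {t. poly (?p w) t = 0})"
    using ex_new_if_finite[OF infinite_UNIV_char_0] by blast
  have eq: "(\<Sum>i\<in>UNIV. (\<alpha> + axis j t) $ i * w $ i) = poly (?p w) t" for w
    by (simp add: distrib_right sum.distrib sum_axis)
  show ?case
    by (rule exI[of _ "\<alpha> + axis j t"], unfold eq) (use t in blast)
qed

lemma ex_nonvanishing_trilinear:
  fixes S :: "('n::finite \<times> 'n \<times> 'n \<Rightarrow> complex) set"
  assumes fin: "finite S" and nz: "(\<lambda>_. 0) \<notin> S"
  shows "\<exists>\<alpha> \<beta> \<gamma>. \<forall>x\<in>S. trilinear x \<alpha> \<beta> \<gamma> \<noteq> 0"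
proof -
  have "\<exists>i j k. x (i, j, k) \<noteq> 0" if "x \<in> S" for x
    using nz that by (metis ext prod_cases3)
  then obtain i j k where ijk: "\<And>x. x \<in> S \<Longrightarrow> x (i x, j x, k x) \<noteq> 0" by metis
  obtain \<alpha> where \<alpha>: "\<And>x. x \<in> S \<Longrightarrow> (\<Sum>i\<in>UNIV. \<alpha> $ i * x (i, j x, k x)) \<noteq> 0"
    using ex_nonvanishing_vector[of "(\<lambda>x. \<chi> i. x (i, j x, k x)) ` S"] fin ijk
    by (fastforce simp: vec_eq_iff)
  obtain \<beta> where \<beta>: "\<And>x. x \<in> S \<Longrightarrow> (\<Sum>j\<in>UNIV. \<beta> $ j * (\<Sum>i\<in>UNIV. \<alpha> $ i * x (i, j, k x))) \<noteq> 0"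
    using ex_nonvanishing_vector[of "(\<lambda>x. \<chi> j. \<Sum>i\<in>UNIV. \<alpha> $ i * x (i, j, k x)) ` S"] fin \<alpha>
    by (fastforce simp: vec_eq_iff)
  obtain \<gamma> where \<gamma>: "\<And>x. x \<in> S \<Longrightarrow>
      (\<Sum>k\<in>UNIV. \<gamma> $ k * (\<Sum>j\<in>UNIV. \<beta> $ j * (\<Sum>i\<in>UNIV. \<alpha> $ i * x (i, j, k)))) \<noteq> 0"
    using ex_nonvanishing_vector[of "(\<lambda>x. \<chi> k. \<Sum>j\<in>UNIV. \<beta> $ j * (\<Sum>i\<in>UNIV. \<alpha> $ i * x (i, j, k))) ` S"] fin \<beta>
    by (fastforce simp: vec_eq_iff)
  then show ?thesis unfolding trilinear_swap_sums by blast
qed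

section \<open>Tensors in the span of a scheme of small degree\<close>

text \<open>In the quotient by \<open>J\<close> the swap relations make \<open>Z\<close> a product \<open>a b c\<close> of three maps, up to a unit.
  If \<open>Z a0 b0 c0\<close> is a unit and \<open>Z a0 b0\<close> reaches every residue class, then the factor that comes from
  \<open>a\<close> can be moved into the last argument.  The proof avoids choosing the factors: with
  \<open>u = Z a0 b0 c0\<close> and \<open>g\<close> its inverse, the required \<open>c'\<close> is a preimage of
  \<open>g (Z a b0 c0) (Z a0 b0 c)\<close> under \<open>Z a0 b0\<close>.\<close>

lemma slice_represents_all_forms:
  fixes Z :: "'a \<Rightarrow> 'b \<Rightarrow> 'c \<Rightarrow> 'i cpoly"
  assumes J: "poly_ideal J"
    and swap1: "\<And>a b c a' b' c'. Z a b c * Z a' b' c' - Z a' b c * Z a b' c' \<in> J"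
    and swap3: "\<And>a b c a' b' c'. Z a b c * Z a' b' c' - Z a b c' * Z a' b' c \<in> J"
    and unit: "1 - g * Z a0 b0 c0 \<in> J"
    and surj: "\<And>f. \<exists>c. f - Z a0 b0 c \<in> J"
  shows "\<exists>c'. Z a b c - Z a0 b c' \<in> J"
proof -
  have add: "\<And>f g. f \<in> J \<Longrightarrow> g \<in> J \<Longrightarrow> f + g \<in> J" and mult: "\<And>f g. g \<in> J \<Longrightarrow> f * g \<in> J"
    using J by (auto simp: poly_ideal_def)
  obtain c' where j2: "g * Z a b0 c0 * Z a0 b0 c - Z a0 b0 c' \<in> J" using surj by blast
  note j3 = swap3[of a0 b0 c0 a0 b c'] and j4 = swap3[of a0 b0 c a0 b c0]
    and j5 = swap1[of a b0 c0 a0 b c]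
  \<comment> \<open>The difference to be shown to lie in \<open>J\<close>, written as a combination of the known elements
    \<open>1 - g u\<close>, \<open>g Q S - P\<close> and three swap relations.\<close>
  have identity: "X - Y = (X - Y + g * Q * V) * (1 - g * u) + g * W * (g * Q * S - P)
      - g * ((u * Y - P * W) + g * Q * (S * W - u * V) + (Q * V - u * X))"
    for X Y Q V u W S P :: "'i cpoly"
    by (simp add: algebra_simps)
  show ?thesis
    by (rule exI[of _ c'], subst identity[where u = "Z a0 b0 c0" and Q = "Z a b0 c0" and V = "Z a0 b c"
          and W = "Z a0 b c0" and S = "Z a0 b0 c" and P = "Z a0 b0 c'"])
      (intro ideal_diff[OF J] add mult unit j2 j3 j4 j5)
qed

text \<open>A dimension count: the quotient by \<open>J\<close> has dimension at most that of the source of \<open>Z\<close>.\<close>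

lemma surjective_of_injective:
  fixes Q :: "'i cpoly \<Rightarrow> complex ^ 'n::finite" and Z :: "complex ^ 'n \<Rightarrow> 'i cpoly"
  assumes Qadd: "\<And>f g. Q (f + g) = Q f + Q g" and Qscale: "\<And>c f. Q (const_poly c * f) = c *s Q f"
    and ker: "\<And>f. Q f = 0 \<longleftrightarrow> f \<in> J"
    and Zadd: "\<And>a b. Z (a + b) = Z a + Z b" and Zscale: "\<And>c a. Z (c *s a) = const_poly c * Z a"
    and inj: "\<And>a. Z a \<in> J \<Longrightarrow> a = 0"
  shows "\<exists>a. f - Z a \<in> J"
proof -
  have lin: "Vector_Spaces.linear (*s) (*s) (\<lambda>a. Q (Z a))"
    by unfold_locales (simp_all add: Qadd Qscale Zadd Zscale)
  have "inj (\<lambda>a. Q (Z a))"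
    using inj ker by (simp add: vec.linear_inj_iff_eq_0[OF lin])
  then have "surj (\<lambda>a. Q (Z a))" by (rule vec.linear_inj_imp_surj[OF lin])
  then obtain a where a: "Q f = Q (Z a)" by (metis surjD)
  have "Q f = Q (f - Z a) + Q (Z a)" using Qadd[of "f - Z a" "Z a"] by simp
  then have "Q (f - Z a) = 0" using a by simp
  then show ?thesis using ker by blast
qed

text \<open>The quotient is padded with zeros to a fixed dimension, so that linear algebra on a finite-dimensional
  vector type applies.\<close>

lemma quotient_algebra_embedding:
  assumes "quotient_algebra J r \<mu>" and r: "r \<le> CARD('n::finite)"
  obtains Q :: "'i cpoly \<Rightarrow> complex ^ 'n"
  where "\<And>f g. Q (f + g) = Q f + Q g" "\<And>c f. Q (const_poly c * f) = c *s Q f"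
    "\<And>f. Q f = 0 \<longleftrightarrow> f \<in> J"
proof -
  obtain q :: "'i cpoly \<Rightarrow> nat \<Rightarrow> complex" where q: "range q = coord_space r"
    "\<And>f g. q (f + g) = (\<lambda>i. q f i + q g i)" "\<And>c f. q (const_poly c * f) = (\<lambda>i. c * q f i)"
    "{f. q f = (\<lambda>i. 0)} = J"
    using assms(1) unfolding quotient_algebra_def by (elim exE conjE) (rule that, simp_all)
  obtain e :: "'n \<Rightarrow> nat" where e: "bij_betw e UNIV {0..<CARD('n)}"
    using ex_bij_betw_finite_nat[of "UNIV :: 'n set"] by auto
  show ?thesis
  proof
    let ?Q = "\<lambda>f. \<chi> i. q f (e i)"
    show "?Q (f + g) = ?Q f + ?Q g" for f g by (simp add: q(2) vec_eq_iff)
    show "?Q (const_poly c * f) = c *s ?Q f" for c f by (simp add: q(3) vec_eq_iff)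
    have "q f = (\<lambda>i. 0)" if "?Q f = 0" for f
    proof
      fix n
      show "q f n = 0"
      proof (cases "n < CARD('n)")
        case True
        then have "n \<in> range e" using e by (simp add: bij_betw_def)
        then obtain i where "n = e i" by blast
        then show ?thesis using that by (simp add: vec_eq_iff)
      next
        case False
        have "q f \<in> coord_space r" using q(1) by blast
        then show ?thesis using False r by (simp add: coord_space_def)
      qed
    qed
    then show "?Q f = 0 \<longleftrightarrow> f \<in> J" for f using q(4) by (auto simp: vec_eq_iff)
  qed
qed

text \<open>On the coordinate ring \<open>R\<close> of the scheme some contraction \<open>z(\<alpha>, \<beta>, \<gamma>)\<close> of the coordinates is a unit,
  because it can be chosen to be nonzero at each of the finitely many points.  By the Segre relations and
  conciseness, fixing two of the arguments \<open>\<alpha>\<close>, \<open>\<beta>\<close>, \<open>\<gamma>\<close> leaves an injective map to \<open>R\<close>, which is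
  bijective since \<open>dim R \<le> CARD('n)\<close>.  Hence a vector in the kernel of the slice at \<open>\<alpha>\<close>
  contracts \<open>T\<close> to zero (\<open>slice_represents_all_forms\<close>), so this kernel is zero by conciseness; the same
  holds for \<open>\<beta>\<close> and \<open>\<gamma>\<close>.\<close>

lemma one_generic_of_scheme:
  fixes T :: "'n::finite tensor"
  assumes conc: "concise T" and scheme: "zero_dim_scheme I r \<mu>" and r: "r \<le> CARD('n)"
    and segre: "segre_ideal \<subseteq> I" and span: "T \<in> linear_span I"
  shows "one_generic T"
proof -
  obtain l where hI: "homogeneous_ideal I" and l: "linear_form l"
    and nzd: "\<And>f. l * f \<in> I \<Longrightarrow> f \<in> I"
    and quot: "quotient_algebra {f + g * (l - 1) | f g. f \<in> I} r \<mu>"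
    using scheme unfolding zero_dim_scheme_def by blast
  define J where "J = {f + g * (l - 1) | f g. f \<in> I}"
  have I: "poly_ideal I" using hI by (simp add: homogeneous_ideal_def)
  have J: "poly_ideal J" and IJ: "I \<subseteq> J" and l1: "l - 1 \<in> J"
    unfolding J_def using ideal_adjoin[OF I] by blast+
  have lin_J: "f \<in> I" if "linear_form f" "f \<in> J" for f
    using that linear_form_dehomogenization[OF hI l nzd] unfolding J_def by blast
  let ?t = "trilinear (tensor_coords T)"
  have T_J: "poly_value f (tensor_coords T) = 0" if "linear_form f" "f \<in> J" for f
    using span lin_J[OF that] that(1) by (simp add: linear_span_def)
  obtain Q :: "_ \<Rightarrow> complex ^ 'n"
    where Qadd: "\<And>f g. Q (f + g) = Q f + Q g" and Qscale: "\<And>c f. Q (const_poly c * f) = c *s Q f"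
      and ker: "\<And>f. Q f = 0 \<longleftrightarrow> f \<in> J"
    by (rule quotient_algebra_embedding[OF quot[folded J_def] r]) (rule that)
  have integral: "\<exists>p. p \<noteq> 0 \<and> eval_poly p f \<in> J" for f
    by (rule integral_of_finite_codimension[OF Qadd Qscale]) (simp add: ker)
  obtain \<alpha> \<beta> \<gamma> where nz: "\<And>x. \<forall>f\<in>J. poly_value f x = 0 \<Longrightarrow> trilinear x \<alpha> \<beta> \<gamma> \<noteq> 0"
  proof -
    have "\<not> (\<forall>f\<in>J. poly_value f (\<lambda>_. 0) = 0)"
      using l1 linear_form_value_0[OF l] by (force simp: poly_value_diff)
    then show ?thesis
      using ex_nonvanishing_trilinear[OF finite_zeros[OF integral]] that by blast
  qed
  let ?Z = segre_form
  \<comment> \<open>If the contraction were not a unit, the Nullstellensatz would give a point where it vanishes.\<close>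
  obtain g where g: "1 - g * ?Z \<alpha> \<beta> \<gamma> \<in> J"
  proof -
    define K where "K = {k + h * ?Z \<alpha> \<beta> \<gamma> | k h. k \<in> J}"
    have K: "poly_ideal K" and JK: "J \<subseteq> K" and ZK: "?Z \<alpha> \<beta> \<gamma> \<in> K"
      unfolding K_def using ideal_adjoin[OF J] by blast+
    have "1 \<in> K"
    proof (rule ccontr)
      assume "1 \<notin> K"
      moreover have "\<exists>p. p \<noteq> 0 \<and> eval_poly p f \<in> K" for f using integral JK by blast
      ultimately obtain x where x: "\<forall>f\<in>K. poly_value f x = 0"
        using nullstellensatz_finite_codimension[OF K] by blast
      have "\<forall>f\<in>J. poly_value f x = 0" using x JK by blast
      then have "trilinear x \<alpha> \<beta> \<gamma> \<noteq> 0" by (rule nz)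
      moreover have "poly_value (?Z \<alpha> \<beta> \<gamma>) x = 0" using x ZK by blast
      ultimately show False by simp
    qed
    then obtain k h where k: "1 = k + h * ?Z \<alpha> \<beta> \<gamma>" "k \<in> J" unfolding K_def by blast
    from k(1) have "1 - h * ?Z \<alpha> \<beta> \<gamma> = k" by (simp only: diff_eq_eq)
    with k(2) have "1 - h * ?Z \<alpha> \<beta> \<gamma> \<in> J" by simp
    then show ?thesis by (rule that)
  qed
  have add: "\<And>f g. f \<in> J \<Longrightarrow> g \<in> J \<Longrightarrow> f + g \<in> J" and mult: "\<And>f g. g \<in> J \<Longrightarrow> f * g \<in> J"
    using J by (auto simp: poly_ideal_def)
  note swA = subsetD[OF subset_trans[OF segre IJ] segre_swap_A]
    and swB = subsetD[OF subset_trans[OF segre IJ] segre_swap_B]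
    and swC = subsetD[OF subset_trans[OF segre IJ] segre_swap_C]
  have cancel: "f \<in> J" if "?Z \<alpha> \<beta> \<gamma> * f - f' \<in> J" "f' \<in> J" for f f'
  proof -
    have "f = f * (1 - g * ?Z \<alpha> \<beta> \<gamma>) + g * ((?Z \<alpha> \<beta> \<gamma> * f - f') + f')"
      by (simp add: algebra_simps)
    moreover have "f * (1 - g * ?Z \<alpha> \<beta> \<gamma>) + g * ((?Z \<alpha> \<beta> \<gamma> * f - f') + f') \<in> J"
      by (intro add mult g that)
    ultimately show ?thesis by (rule ssubst)
  qed
  have zero: "?t a b c = 0" if "?Z a b c \<in> J" for a b c
    using T_J[OF linear_form_segre_form that] by simp
  have multr: "f * g \<in> J" if "f \<in> J" for f g using mult[OF that, of g] by (simp add: mult.commute)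
  have injA: "a = 0" if a: "?Z a \<beta> \<gamma> \<in> J" for a
    by (rule concise_trilinear(1)[OF conc], rule zero, rule cancel[OF swA multr[OF a]])
  have injB: "b = 0" if b: "?Z \<alpha> b \<gamma> \<in> J" for b
    by (rule concise_trilinear(2)[OF conc], rule zero, rule cancel[OF swB multr[OF b]])
  have injC: "c = 0" if c: "?Z \<alpha> \<beta> c \<in> J" for c
    by (rule concise_trilinear(3)[OF conc], rule zero, rule cancel[OF swC multr[OF c]])
  have surjB: "\<exists>b. f - ?Z \<alpha> b \<gamma> \<in> J" for f
    by (rule surjective_of_injective[OF Qadd Qscale ker segre_form_add_B segre_form_scale_B injB])
  have surjA: "\<exists>a. f - ?Z a \<beta> \<gamma> \<in> J" for f
    by (rule surjective_of_injective[OF Qadd Qscale ker segre_form_add_A segre_form_scale_A injA])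
  have eq: "?t a b c = ?t a' b' c'" if "?Z a b c - ?Z a' b' c' \<in> J" for a b c a' b' c'
    using T_J[OF linear_form_diff[OF linear_form_segre_form linear_form_segre_form] that]
    by (simp add: poly_value_diff)
  have "det (slice_A T \<alpha>) \<noteq> 0"
    unfolding det_nonzero_iff_kernel
  proof (intro allI impI)
    fix c assume "slice_A T \<alpha> *v c = 0"
    then have 0: "?t \<alpha> b c = 0" for b
      by (simp add: trilinear_slice_A matrix_vector_mult_def vec_eq_iff mult.assoc
          flip: sum_distrib_left) (simp add: mult.commute)
    show "c = 0"
    proof (rule concise_trilinear(3)[OF conc])
      fix a b
      obtain b' where "?Z a b c - ?Z \<alpha> b' c \<in> J"
        using slice_represents_all_forms[where Z = "\<lambda>a c b. ?Z a b c", OF J swA swB g surjB] by blast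
      then show "?t a b c = 0" using eq 0 by metis
    qed
  qed
  moreover have "det (slice_B T \<beta>) \<noteq> 0"
    unfolding det_nonzero_iff_kernel
  proof (intro allI impI)
    fix c assume "slice_B T \<beta> *v c = 0"
    then have 0: "?t a \<beta> c = 0" for a
      by (simp add: trilinear_slice_B matrix_vector_mult_def vec_eq_iff mult.assoc
          flip: sum_distrib_left) (simp add: mult.commute)
    show "c = 0"
    proof (rule concise_trilinear(3)[OF conc])
      fix a b
      obtain a' where "?Z a b c - ?Z a' \<beta> c \<in> J"
        using slice_represents_all_forms[where Z = "\<lambda>b c a. ?Z a b c", OF J swB swA g surjA] by blast
      then show "?t a b c = 0" using eq 0 by metis
    qed
  qed
  moreover have "det (slice_C T \<gamma>) \<noteq> 0"
    unfolding det_nonzero_iff_kernel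
  proof (intro allI impI)
    fix b assume "slice_C T \<gamma> *v b = 0"
    then have 0: "?t a b \<gamma> = 0" for a
      by (simp add: trilinear_slice_C matrix_vector_mult_def vec_eq_iff mult.assoc
          flip: sum_distrib_left) (simp add: mult.commute)
    show "b = 0"
    proof (rule concise_trilinear(2)[OF conc])
      fix a c
      obtain a' where "?Z a b c - ?Z a' b \<gamma> \<in> J"
        using slice_represents_all_forms[where Z = "\<lambda>c b a. ?Z a b c", OF J swC swA g surjA] by blast
      then show "?t a b c = 0" using eq 0 by metis
    qed
  qed
  ultimately show ?thesis
    unfolding one_generic_def one_A_generic_def one_B_generic_def one_C_generic_def
    by (auto simp: full_rank_iff_det)
qed

section \<open>Limits of algebras of reduced points\<close>

text \<open>Working with the functions rather than with polynomials keeps the equations of the base of the family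
  readable.\<close>

definition polynomial_function :: "((nat \<Rightarrow> complex) \<Rightarrow> complex) \<Rightarrow> bool" where
  "polynomial_function g \<longleftrightarrow> (\<exists>f. \<forall>s. poly_value f s = g s)"

lemma polynomial_function_const: "polynomial_function (\<lambda>s. c)"
  unfolding polynomial_function_def by (rule exI[of _ "const_poly c"]) simp

lemma polynomial_function_coord: "polynomial_function (\<lambda>s. s i)"
  unfolding polynomial_function_def by (rule exI[of _ "var i"]) simp

lemma polynomial_function_add:
  "polynomial_function g \<Longrightarrow> polynomial_function h \<Longrightarrow> polynomial_function (\<lambda>s. g s + h s)"
  unfolding polynomial_function_def by (metis poly_value_add)

lemma polynomial_function_diff:
  "polynomial_function g \<Longrightarrow> polynomial_function h \<Longrightarrow> polynomial_function (\<lambda>s. g s - h s)"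
  unfolding polynomial_function_def by (metis poly_value_diff)

lemma polynomial_function_mult:
  "polynomial_function g \<Longrightarrow> polynomial_function h \<Longrightarrow> polynomial_function (\<lambda>s. g s * h s)"
  unfolding polynomial_function_def by (metis poly_value_mult)

lemma polynomial_function_sum:
  "(\<And>i. i \<in> S \<Longrightarrow> polynomial_function (g i)) \<Longrightarrow> polynomial_function (\<lambda>s. \<Sum>i\<in>S. g i s)"
  by (induction S rule: infinite_finite_induct)
    (simp_all add: polynomial_function_const polynomial_function_add)

lemmas polynomial_function_intros = polynomial_function_const polynomial_function_coord
  polynomial_function_add polynomial_function_diff polynomial_function_mult polynomial_function_sum

lemma algebraic_set_polynomial_equations:
  assumes "\<And>g. g \<in> G \<Longrightarrow> polynomial_function g"
  shows "algebraic_set N {s \<in> coord_space N. \<forall>g\<in>G. g s = 0}"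
  unfolding algebraic_set_def
proof (rule exI[of _ "{f. \<exists>g\<in>G. \<forall>s. poly_value f s = g s}"], intro set_eqI iffI)
  fix s assume "s \<in> {s \<in> coord_space N. \<forall>f\<in>{f. \<exists>g\<in>G. \<forall>s. poly_value f s = g s}. poly_value f s = 0}"
  then show "s \<in> {s \<in> coord_space N. \<forall>g\<in>G. g s = 0}"
    using assms unfolding polynomial_function_def by force
qed auto

text \<open>The unit is prescribed because the structure constants of algebras with an arbitrary unit do not form
  a closed set.\<close>

definition unital_comm_algebra :: "nat \<Rightarrow> (nat \<Rightarrow> complex) \<Rightarrow> structure_constants \<Rightarrow> bool" where
  "unital_comm_algebra r e \<mu> \<longleftrightarrow>
     (\<forall>x\<in>coord_space r. \<forall>y\<in>coord_space r. alg_mult r \<mu> x y = alg_mult r \<mu> y x) \<and>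
     (\<forall>x\<in>coord_space r. \<forall>y\<in>coord_space r. \<forall>z\<in>coord_space r.
        alg_mult r \<mu> (alg_mult r \<mu> x y) z = alg_mult r \<mu> x (alg_mult r \<mu> y z)) \<and>
     (\<forall>x\<in>coord_space r. alg_mult r \<mu> e x = x)"

lemma comm_algebra_if_unital: "e \<in> coord_space r \<Longrightarrow> unital_comm_algebra r e \<mu> \<Longrightarrow> comm_algebra r \<mu>"
  unfolding unital_comm_algebra_def comm_algebra_def by blast

lemma alg_mult_cong:
  "(\<And>i j k. i < r \<Longrightarrow> j < r \<Longrightarrow> k < r \<Longrightarrow> \<mu> i j k = \<nu> i j k) \<Longrightarrow> alg_mult r \<mu> = alg_mult r \<nu>"
  unfolding alg_mult_def by (intro ext) simp

lemma tendsto_alg_mult: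
  assumes "\<And>i j k. ((\<lambda>n. \<mu> n i j k) \<longlongrightarrow> \<nu> i j k) F"
    and "\<And>i. ((\<lambda>n. x n i) \<longlongrightarrow> x' i) F" and "\<And>i. ((\<lambda>n. y n i) \<longlongrightarrow> y' i) F"
  shows "((\<lambda>n. alg_mult r (\<mu> n) (x n) (y n) k) \<longlongrightarrow> alg_mult r \<nu> x' y' k) F"
  unfolding alg_mult_def by (cases "k < r") (auto intro!: tendsto_intros assms)

lemma polynomial_function_alg_mult:
  assumes "\<And>i. polynomial_function (\<lambda>s. x s i)" "\<And>i. polynomial_function (\<lambda>s. y s i)"
    and "\<And>i j k. polynomial_function (\<lambda>s. \<mu> s i j k)"
  shows "polynomial_function (\<lambda>s. alg_mult r (\<mu> s) (x s) (y s) k)"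
  unfolding alg_mult_def by (cases "k < r") (simp_all add: polynomial_function_intros assms)

text \<open>The base of the family consists of all structure constants of commutative associative algebras with
  unit \<open>e\<close>.  It is given by polynomial equations, so it is closed and contains the limit.\<close>

lemma smoothable_limit:
  assumes e: "e \<in> coord_space r"
    and alg: "\<And>n. unital_comm_algebra r e (\<mu> n)"
    and red: "\<And>n. r_reduced_points r (\<mu> n)"
    and lim: "\<And>i j k. (\<lambda>n. \<mu> n i j k) \<longlonglongrightarrow> \<nu> i j k"
  shows "smoothable r \<nu>"
proof -
  \<comment> \<open>The structure constants are the coordinates of the base, numbered by a pairing function.\<close>
  define enc where "enc i j k = prod_encode (i, prod_encode (j, k))" for i j k
  have "finite ((\<lambda>(i, j, k). enc i j k) ` ({..<r} \<times> {..<r} \<times> {..<r}))" by simp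
  then obtain N where N: "\<forall>x\<in>(\<lambda>(i, j, k). enc i j k) ` ({..<r} \<times> {..<r} \<times> {..<r}). x < N"
    using finite_nat_set_iff_bounded by blast
  have enc_less: "enc i j k < N" if "i < r" "j < r" "k < r" for i j k
    using N that by force
  define M where "M i j k = (var (enc i j k) :: nat cpoly)" for i j k
  have fibre: "family_fibre M s i j k = s (enc i j k)" for s i j k
    by (simp add: family_fibre_def M_def)
  define G where "G = (\<lambda>(x, y, k) s. alg_mult r (family_fibre M s) x y k - alg_mult r (family_fibre M s) y x k)
        ` (coord_space r \<times> coord_space r \<times> UNIV)
    \<union> (\<lambda>(x, y, z, k) s. alg_mult r (family_fibre M s) (alg_mult r (family_fibre M s) x y) z k
          - alg_mult r (family_fibre M s) x (alg_mult r (family_fibre M s) y z) k)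
        ` (coord_space r \<times> coord_space r \<times> coord_space r \<times> UNIV)
    \<union> (\<lambda>(x, k) s. alg_mult r (family_fibre M s) e x k - x k) ` (coord_space r \<times> UNIV)"
  have G_poly: "polynomial_function g" if "g \<in> G" for g
    using that unfolding G_def
    by (auto simp: fibre intro!: polynomial_function_intros polynomial_function_alg_mult)
  have G_iff: "(\<forall>g\<in>G. g s = 0) \<longleftrightarrow> unital_comm_algebra r e (family_fibre M s)" for s
    unfolding G_def unital_comm_algebra_def by (simp add: ball_Un fun_eq_iff)
  define V where "V = {s \<in> coord_space N. \<forall>g\<in>G. g s = 0}"
  have V: "finite_flat_family r N V M"
    unfolding finite_flat_family_def V_def
    using algebraic_set_polynomial_equations[of G N] G_poly comm_algebra_if_unital[OF e] G_iff by auto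
  define point where "point \<mu>' x = (if x < N then
      case prod_decode x of (i, jk) \<Rightarrow> case prod_decode jk of (j, k) \<Rightarrow> \<mu>' i j k else 0)"
    for \<mu>' :: structure_constants and x
  have point_coord: "point \<mu>' \<in> coord_space N" for \<mu>' by (simp add: point_def coord_space_def)
  have fibre_point: "alg_mult r (family_fibre M (point \<mu>')) = alg_mult r \<mu>'" for \<mu>'
    by (rule alg_mult_cong) (simp add: fibre point_def enc_less, simp add: enc_def)
  have point_lim: "(\<lambda>n. point (\<mu> n) x) \<longlonglongrightarrow> point \<nu> x" for x
    unfolding point_def using lim by (simp split: prod.splits)
  have in_V: "point (\<mu> n) \<in> V" for n
    using alg[of n] unfolding V_def mem_Collect_eq G_iff unital_comm_algebra_def fibre_point
    by (simp add: point_coord)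
  have "point \<nu> \<in> V"
    unfolding V_def
  proof (intro CollectI conjI ballI point_coord)
    fix g assume g: "g \<in> G"
    obtain f where f: "\<And>s. poly_value f s = g s"
      using G_poly[OF g] unfolding polynomial_function_def by blast
    have "(\<lambda>n. g (point (\<mu> n))) \<longlonglongrightarrow> g (point \<nu>)"
      using tendsto_poly_value[of "\<lambda>n. point (\<mu> n)" "point \<nu>" sequentially f] point_lim f by simp
    moreover have "g (point (\<mu> n)) = 0" for n using in_V g unfolding V_def by blast
    ultimately show "g (point \<nu>) = 0" by (simp add: LIMSEQ_const_iff)
  qed
  moreover have "alg_isomorphic r (family_fibre M (point \<nu>)) \<nu>"
    unfolding alg_isomorphic_def fibre_point by (rule exI[of _ id]) simp
  moreover have "r_reduced_points r (family_fibre M (point (\<mu> n)))" for n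
    using red[of n] unfolding r_reduced_points_def alg_isomorphic_def fibre_point .
  ultimately show ?thesis
    unfolding smoothable_def
    by (intro exI[of _ N] exI[of _ V] exI[of _ M] exI[of _ "point \<nu>"] exI[of _ "\<lambda>n. point (\<mu> n)"]
        conjI allI V in_V point_lim)
qed

section \<open>Structure constants of products on coordinate vectors\<close>

definition index_of :: "'n::finite \<Rightarrow> nat" where
  "index_of = (SOME e. bij_betw e UNIV {..<CARD('n)})"

definition at_index :: "nat \<Rightarrow> 'n::finite" where
  "at_index = inv_into UNIV index_of"

lemma bij_index_of: "bij_betw (index_of :: 'n::finite \<Rightarrow> nat) UNIV {..<CARD('n)}"
  unfolding index_of_def using ex_bij_betw_finite_nat[of "UNIV :: 'n set"]
  by (intro someI_ex[of "\<lambda>e. bij_betw e UNIV {..<CARD('n)}"]) (simp add: atLeast0LessThan)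

lemma at_index_index_of [simp]: "at_index (index_of i) = i"
  using bij_index_of unfolding at_index_def by (metis bij_betw_def inv_into_f_f UNIV_I)

lemma index_of_at_index [simp]: "k < CARD('n) \<Longrightarrow> index_of (at_index k :: 'n::finite) = k"
  using bij_index_of[where 'n = 'n] unfolding at_index_def
  by (metis bij_betw_def f_inv_into_f lessThan_iff)

lemma index_of_less [simp]: "index_of (i :: 'n::finite) < CARD('n)"
  using bij_index_of[where 'n = 'n] by (auto simp: bij_betw_def)

lemma sum_at_index: "(\<Sum>i<CARD('n). h (at_index i :: 'n::finite)) = (\<Sum>i\<in>UNIV. h i)"
  by (rule sum.reindex_bij_witness[of _ index_of at_index]) auto

definition to_coords :: "complex ^ 'n::finite \<Rightarrow> nat \<Rightarrow> complex" where
  "to_coords v = (\<lambda>i. if i < CARD('n) then v $ at_index i else 0)"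

definition from_coords :: "(nat \<Rightarrow> complex) \<Rightarrow> complex ^ 'n::finite" where
  "from_coords x = (\<chi> i. x (index_of i))"

lemma from_to_coords [simp]: "from_coords (to_coords v) = v"
  by (simp add: from_coords_def to_coords_def vec_eq_iff)

lemma to_from_coords [simp]:
  "x \<in> coord_space CARD('n) \<Longrightarrow> to_coords (from_coords x :: complex ^ 'n::finite) = x"
  by (auto simp: from_coords_def to_coords_def coord_space_def fun_eq_iff)

lemma to_coords_in [simp]: "to_coords (v :: complex ^ 'n::finite) \<in> coord_space CARD('n)"
  by (simp add: to_coords_def coord_space_def)

lemma to_coords_add: "to_coords (v + w) = (\<lambda>i. to_coords v i + to_coords w i)"
  and to_coords_scale: "to_coords (c *s v) = (\<lambda>i. c * to_coords v i)"
  and to_coords_0: "to_coords 0 = (\<lambda>i. 0)"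
  by (simp_all add: to_coords_def fun_eq_iff)

lemma to_coords_eq_iff [simp]: "to_coords v = to_coords w \<longleftrightarrow> v = w"
  by (metis from_to_coords)

lemma coord_space_cases:
  assumes "x \<in> coord_space CARD('n)"
  obtains v :: "complex ^ 'n::finite" where "x = to_coords v"
  using to_from_coords[OF assms] by metis

lemma tendsto_to_coords:
  "(v \<longlongrightarrow> w) F \<Longrightarrow> ((\<lambda>n. to_coords (v n) i) \<longlongrightarrow> to_coords w i) F"
  by (simp add: to_coords_def tendsto_vec_nth)

definition structure_of ::
  "(complex ^ 'n::finite \<Rightarrow> complex ^ 'n \<Rightarrow> complex ^ 'n) \<Rightarrow> structure_constants" where
  "structure_of mul i j k = to_coords (mul (axis (at_index i) 1) (axis (at_index j) 1)) k"

lemma alg_mult_structure_of: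
  fixes mul :: "complex ^ 'n::finite \<Rightarrow> complex ^ 'n \<Rightarrow> complex ^ 'n"
  assumes add1: "\<And>a b c. mul (a + b) c = mul a c + mul b c" and add2: "\<And>a b c. mul a (b + c) = mul a b + mul a c"
    and scale1: "\<And>t a b. mul (t *s a) b = t *s mul a b" and scale2: "\<And>t a b. mul a (t *s b) = t *s mul a b"
  shows "alg_mult CARD('n) (structure_of mul) (to_coords v) (to_coords w) = to_coords (mul v w)"
proof
  fix k
  have z1: "mul 0 c = 0" and z2: "mul c 0 = 0" for c using add1[of 0 0 c] add2[of c 0 0] by simp_all
  have sum1: "mul (\<Sum>i\<in>S. a i) c = (\<Sum>i\<in>S. mul (a i) c)" for S c and a :: "'n \<Rightarrow> complex ^ 'n"
    by (induction S rule: infinite_finite_induct) (simp_all add: z1 add1)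
  have sum2: "mul c (\<Sum>i\<in>S. a i) = (\<Sum>i\<in>S. mul c (a i))" for S c and a :: "'n \<Rightarrow> complex ^ 'n"
    by (induction S rule: infinite_finite_induct) (simp_all add: z2 add2)
  have mul: "mul v w = (\<Sum>i\<in>UNIV. \<Sum>j\<in>UNIV. (v $ i * w $ j) *s mul (axis i 1) (axis j 1))"
  proof -
    have "mul v w = (\<Sum>i\<in>UNIV. v $ i *s mul (axis i 1) w)"
      by (subst basis_expansion[of v, symmetric]) (simp only: sum1 scale1)
    moreover have "mul a w = (\<Sum>j\<in>UNIV. w $ j *s mul a (axis j 1))" for a
      by (subst basis_expansion[of w, symmetric]) (simp only: sum2 scale2)
    ultimately show ?thesis by (simp add: vec.scale_sum_right)
  qed
  show "alg_mult CARD('n) (structure_of mul) (to_coords v) (to_coords w) k = to_coords (mul v w) k"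
  proof (cases "k < CARD('n)")
    case True
    have "alg_mult CARD('n) (structure_of mul) (to_coords v) (to_coords w) k
        = (\<Sum>i<CARD('n). \<Sum>j<CARD('n).
            mul (axis (at_index i) 1) (axis (at_index j) 1) $ at_index k * v $ at_index i * w $ at_index j)"
      using True by (simp add: alg_mult_def structure_of_def to_coords_def)
    also have "\<dots> = (\<Sum>i\<in>UNIV. \<Sum>j\<in>UNIV. mul (axis i 1) (axis j 1) $ at_index k * v $ i * w $ j)"
      by (simp only: sum_at_index[of "\<lambda>j. mul (axis _ 1) (axis j 1) $ at_index k * v $ _ * w $ j"]
          sum_at_index[of "\<lambda>i. \<Sum>j\<in>UNIV. mul (axis i 1) (axis j 1) $ at_index k * v $ i * w $ j"])
    also have "\<dots> = to_coords (mul v w) k"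
      using True by (simp add: mul to_coords_def ac_simps)
    finally show ?thesis .
  next
    case False
    then show ?thesis by (simp add: alg_mult_def to_coords_def)
  qed
qed

lemma alg_mult_points:
  fixes v w :: "complex ^ 'n::finite"
  shows "alg_mult CARD('n) points_algebra (to_coords v) (to_coords w) = to_coords (v * w)"
proof
  fix k
  have "(\<Sum>i<CARD('n). \<Sum>j<CARD('n). points_algebra i j k * to_coords v i * to_coords w j)
      = to_coords v k * to_coords w k" if k: "k < CARD('n)"
  proof -
    have "(\<Sum>i<CARD('n). \<Sum>j<CARD('n). points_algebra i j k * to_coords v i * to_coords w j)
      = (\<Sum>i<CARD('n). \<Sum>j<CARD('n). if j = k then (if i = k then to_coords v i * to_coords w j else 0) else 0)"
      by (intro sum.cong) (auto simp: points_algebra_def)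
    also have "\<dots> = to_coords v k * to_coords w k" using k by (simp add: sum.delta)
    finally show ?thesis .
  qed
  then show "alg_mult CARD('n) points_algebra (to_coords v) (to_coords w) k = to_coords (v * w) k"
    by (simp add: alg_mult_def) (simp add: to_coords_def)
qed

text \<open>The componentwise product carried along the isomorphism \<open>A\<close>, with \<open>B\<close> in the role of the inverse.\<close>

definition transported_product ::
  "complex ^ 'n ^ 'n \<Rightarrow> complex ^ 'n ^ 'n \<Rightarrow> complex ^ 'n \<Rightarrow> complex ^ 'n \<Rightarrow> complex ^ 'n::finite" where
  "transported_product A B v w = B *v ((A *v v) * (A *v w))"

lemma vec_scale_mult:
  fixes v w :: "complex ^ 'n"
  shows "(c *s v) * w = c *s (v * w)" "v * (c *s w) = c *s (v * w)"
  by (simp_all add: vec_eq_iff)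

lemma alg_mult_transported:
  fixes A B :: "complex ^ 'n ^ 'n::finite"
  shows "alg_mult CARD('n) (structure_of (transported_product A B)) (to_coords v) (to_coords w)
    = to_coords (transported_product A B v w)"
  by (rule alg_mult_structure_of)
    (simp_all add: transported_product_def matrix_vector_right_distrib vec.scale distrib_left distrib_right
      vec_scale_mult)

lemma matrix_mult_inverse_vector:
  assumes "A ** B = mat 1" shows "A *v (B *v v) = v"
  using assms by (simp add: matrix_vector_mul_assoc)

lemma transported_unital_comm_algebra:
  fixes A B :: "complex ^ 'n ^ 'n::finite"
  assumes AB: "A ** B = mat 1" "B ** A = mat 1" and u: "A *v u = 1"
  shows "unital_comm_algebra CARD('n) (to_coords u) (structure_of (transported_product A B))"
  unfolding unital_comm_algebra_def
proof (intro conjI ballI)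
  note inv = matrix_mult_inverse_vector[OF AB(1)] matrix_mult_inverse_vector[OF AB(2)]
  fix x assume "x \<in> coord_space CARD('n)"
  then obtain v :: "complex ^ 'n" where v: "x = to_coords v" by (rule coord_space_cases)
  show "alg_mult CARD('n) (structure_of (transported_product A B)) (to_coords u) x = x"
    unfolding v alg_mult_transported by (simp add: transported_product_def u inv)
  fix y assume "y \<in> coord_space CARD('n)"
  then obtain w :: "complex ^ 'n" where w: "y = to_coords w" by (rule coord_space_cases)
  show "alg_mult CARD('n) (structure_of (transported_product A B)) x y
      = alg_mult CARD('n) (structure_of (transported_product A B)) y x"
    unfolding v w alg_mult_transported by (simp add: transported_product_def mult.commute)
  fix z assume "z \<in> coord_space CARD('n)"
  then obtain t :: "complex ^ 'n" where t: "z = to_coords t" by (rule coord_space_cases)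
  show "alg_mult CARD('n) (structure_of (transported_product A B))
        (alg_mult CARD('n) (structure_of (transported_product A B)) x y) z
      = alg_mult CARD('n) (structure_of (transported_product A B)) x
        (alg_mult CARD('n) (structure_of (transported_product A B)) y z)"
    unfolding v w t alg_mult_transported by (simp add: transported_product_def inv mult.assoc)
qed

lemma transported_reduced_points:
  fixes A B :: "complex ^ 'n ^ 'n::finite"
  assumes AB: "A ** B = mat 1" "B ** A = mat 1"
  shows "r_reduced_points CARD('n) (structure_of (transported_product A B))"
  unfolding r_reduced_points_def alg_isomorphic_def
proof (intro exI conjI ballI allI)
  note inv = matrix_mult_inverse_vector[OF AB(1)] matrix_mult_inverse_vector[OF AB(2)]
  let ?h = "\<lambda>x. to_coords (A *v from_coords x)"
  show "bij_betw ?h (coord_space CARD('n)) (coord_space CARD('n))"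
    by (rule bij_betw_byWitness[where f' = "\<lambda>x. to_coords (B *v from_coords x)"]) (auto simp: inv)
  fix x assume "x \<in> coord_space CARD('n)"
  then obtain v :: "complex ^ 'n" where v: "x = to_coords v" by (rule coord_space_cases)
  show "?h (\<lambda>i. c * x i) = (\<lambda>i. c * ?h x i)" for c
    unfolding v to_coords_scale[symmetric] by (simp add: vec.scale)
  fix y assume "y \<in> coord_space CARD('n)"
  then obtain w :: "complex ^ 'n" where w: "y = to_coords w" by (rule coord_space_cases)
  show "?h (\<lambda>i. x i + y i) = (\<lambda>i. ?h x i + ?h y i)"
    unfolding v w to_coords_add[symmetric] by (simp add: matrix_vector_right_distrib)
  show "?h (alg_mult CARD('n) (structure_of (transported_product A B)) x y)
      = alg_mult CARD('n) points_algebra (?h x) (?h y)"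
    unfolding v w alg_mult_transported alg_mult_points by (simp add: transported_product_def inv)
qed

section \<open>Limits of solutions and of contractions\<close>

lemma tendsto_det:
  fixes M :: "nat \<Rightarrow> complex ^ 'n ^ 'n::finite"
  assumes "M \<longlonglongrightarrow> M'"
  shows "(\<lambda>n. det (M n)) \<longlonglongrightarrow> det M'"
  unfolding det_def by (intro tendsto_intros tendsto_vec_nth assms)

text \<open>By Cramer's rule the solution of a linear system is a continuous function of the matrix and the right
  hand side wherever the determinant does not vanish.\<close>

lemma convergent_solution:
  fixes M :: "nat \<Rightarrow> complex ^ 'n ^ 'n::finite"
  assumes M: "M \<longlonglongrightarrow> M'" and det: "det M' \<noteq> 0"
    and conv: "\<And>k. convergent (\<lambda>n. (M n *v x n) $ k)"
  shows "convergent x"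
proof -
  obtain b where b: "\<And>k. (\<lambda>n. (M n *v x n) $ k) \<longlonglongrightarrow> b $ k"
  proof -
    obtain c where c: "\<And>k. (\<lambda>n. (M n *v x n) $ k) \<longlonglongrightarrow> c k" using conv unfolding convergent_def by metis
    show ?thesis by (rule that[of "\<chi> k. c k"]) (simp add: c)
  qed
  let ?s = "\<lambda>M b. \<chi> k. det (\<chi> i j. if j = k then b $ i else M $ i $ j) / det M"
  have "(\<lambda>n. ?s (M n) (M n *v x n)) \<longlonglongrightarrow> ?s M' b"
  proof (intro vec_tendstoI, unfold vec_lambda_beta, intro tendsto_divide tendsto_det det M vec_tendstoI, unfold vec_lambda_beta)
    fix k i j
    show "(\<lambda>n. if j = k then (M n *v x n) $ i else M n $ i $ j) \<longlonglongrightarrow> (if j = k then b $ i else M' $ i $ j)"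
      using b M by (auto intro: tendsto_vec_nth)
  qed
  moreover have "\<forall>\<^sub>F n in sequentially. ?s (M n) (M n *v x n) = x n"
    using tendsto_imp_eventually_ne[OF tendsto_det[OF M] det]
  proof eventually_elim
    case (elim n)
    show ?case by (rule sym, rule iffD1[OF cramer[OF elim] refl])
  qed
  ultimately have "x \<longlonglongrightarrow> ?s M' b" by (rule Lim_transform_eventually)
  then show ?thesis unfolding convergent_def by blast
qed

lemma tendsto_slices:
  assumes "X \<longlonglongrightarrow> T"
  shows tendsto_slice_A: "(\<lambda>n. slice_A (X n) \<alpha>) \<longlonglongrightarrow> slice_A T \<alpha>"
    and tendsto_slice_B: "(\<lambda>n. slice_B (X n) \<beta>) \<longlonglongrightarrow> slice_B T \<beta>"
    and tendsto_slice_C: "(\<lambda>n. slice_C (X n) \<gamma>) \<longlonglongrightarrow> slice_C T \<gamma>"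
  unfolding slice_A_def slice_B_def slice_C_def
  by (intro vec_tendstoI, unfold vec_lambda_beta, intro tendsto_intros tendsto_vec_nth assms)+

lemma tendsto_transpose:
  fixes M :: "nat \<Rightarrow> complex ^ 'n ^ 'n::finite"
  shows "M \<longlonglongrightarrow> M' \<Longrightarrow> (\<lambda>n. transpose (M n)) \<longlonglongrightarrow> transpose M'"
  unfolding transpose_def by (intro vec_tendstoI, unfold vec_lambda_beta, intro tendsto_vec_nth)

lemma tendsto_tensor_coords: "X \<longlonglongrightarrow> T \<Longrightarrow> (\<lambda>n. tensor_coords (X n) p) \<longlonglongrightarrow> tensor_coords T p"
  unfolding tensor_coords_def by (cases p) (simp, intro tendsto_vec_nth)

lemma tendsto_trilinear:
  assumes "X \<longlonglongrightarrow> T" "\<alpha> \<longlonglongrightarrow> \<alpha>'" "\<beta> \<longlonglongrightarrow> \<beta>'" "\<gamma> \<longlonglongrightarrow> \<gamma>'"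
  shows "(\<lambda>n. trilinear (tensor_coords (X n)) (\<alpha> n) (\<beta> n) (\<gamma> n)) \<longlonglongrightarrow> trilinear (tensor_coords T) \<alpha>' \<beta>' \<gamma>'"
  unfolding trilinear_def by (intro tendsto_intros tendsto_vec_nth tendsto_tensor_coords assms)

section \<open>Sums of as many rank one tensors as there are coordinates\<close>

text \<open>The sum of the tensors \<open>w\<^sub>l a\<^sub>l \<otimes> b\<^sub>l \<otimes> c\<^sub>l\<close>, where \<open>a\<^sub>l\<close>, \<open>b\<^sub>l\<close>, \<open>c\<^sub>l\<close> are the rows of three square matrices.
  A slice of it is then a product of two of these matrices with a diagonal matrix in between.\<close>

definition weighted_sum ::
  "complex ^ 'n \<Rightarrow> complex ^ 'n ^ 'n \<Rightarrow> complex ^ 'n ^ 'n \<Rightarrow> complex ^ 'n ^ 'n \<Rightarrow> 'n::finite tensor" where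
  "weighted_sum w A B C = (\<chi> i j k. \<Sum>l\<in>UNIV. w $ l * A $ l $ i * B $ l $ j * C $ l $ k)"

lemma tensor_coords_weighted_sum:
  "tensor_coords (weighted_sum w A B C)
    = (\<lambda>p. \<Sum>l\<in>UNIV. w $ l * tensor_coords (outer (A $ l) (B $ l) (C $ l)) p)"
  by (auto simp: tensor_coords_def weighted_sum_def outer_def mult.assoc fun_eq_iff)

lemma trilinear_outer_rows:
  "trilinear (tensor_coords (outer (A $ l) (B $ l) (C $ l))) \<alpha> \<beta> \<gamma>
    = (A *v \<alpha>) $ l * (B *v \<beta>) $ l * (C *v \<gamma>) $ l"
  by (simp add: trilinear_outer matrix_vector_mult_def mult.commute)

lemma trilinear_weighted_sum:
  "trilinear (tensor_coords (weighted_sum w A B C)) \<alpha> \<beta> \<gamma>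
    = (\<Sum>l\<in>UNIV. w $ l * ((A *v \<alpha>) $ l * (B *v \<beta>) $ l * (C *v \<gamma>) $ l))"
  using poly_value_linear_combination[OF linear_form_segre_form[of \<alpha> \<beta> \<gamma>], of "\<lambda>l. w $ l"
      "\<lambda>l. tensor_coords (outer (A $ l) (B $ l) (C $ l))" UNIV]
  by (simp add: tensor_coords_weighted_sum trilinear_outer_rows)

lemma det_weighted_gram:
  fixes P Q :: "complex ^ 'n ^ 'n::finite"
  shows "det (\<chi> j k. \<Sum>l\<in>UNIV. d l * P $ l $ j * Q $ l $ k) = det P * (\<Prod>l\<in>UNIV. d l) * det Q"
proof -
  let ?D = "(\<chi> i j. if i = j then d i else 0) :: complex ^ 'n ^ 'n"
  have "(\<chi> j k. \<Sum>l\<in>UNIV. d l * P $ l $ j * Q $ l $ k) = transpose P ** ?D ** Q"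
    by (simp add: vec_eq_iff matrix_matrix_mult_def transpose_def if_distrib sum.delta ac_simps cong: if_cong)
  moreover have "det ?D = (\<Prod>l\<in>UNIV. d l)" by (subst det_diagonal) simp_all
  ultimately show ?thesis by (simp add: det_mul)
qed

lemma det_slices_weighted_sum:
  shows det_slice_A_weighted_sum: "det (slice_A (weighted_sum w A B C) \<alpha>)
      = det B * (\<Prod>l\<in>UNIV. w $ l * (A *v \<alpha>) $ l) * det C"
    and det_slice_B_weighted_sum: "det (slice_B (weighted_sum w A B C) \<beta>)
      = det A * (\<Prod>l\<in>UNIV. w $ l * (B *v \<beta>) $ l) * det C"
    and det_slice_C_weighted_sum: "det (slice_C (weighted_sum w A B C) \<gamma>)
      = det A * (\<Prod>l\<in>UNIV. w $ l * (C *v \<gamma>) $ l) * det B"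
proof -
  have swap: "(\<Sum>i\<in>UNIV. v $ i * (\<Sum>l\<in>UNIV. h l * M $ l $ i)) = (\<Sum>l\<in>UNIV. h l * (M *v v) $ l)"
    for v :: "complex ^ 'n" and M :: "complex ^ 'n ^ 'n" and h
    unfolding sum_distrib_left matrix_vector_mult_def by (subst sum.swap) (simp add: sum_distrib_left ac_simps)
  have "slice_A (weighted_sum w A B C) \<alpha> = (\<chi> j k. \<Sum>l\<in>UNIV. (w $ l * (A *v \<alpha>) $ l) * B $ l $ j * C $ l $ k)"
    using swap[of \<alpha> "\<lambda>l. w $ l * B $ l $ _ * C $ l $ _" A]
    by (simp add: slice_A_def weighted_sum_def vec_eq_iff ac_simps)
  then show "det (slice_A (weighted_sum w A B C) \<alpha>) = det B * (\<Prod>l\<in>UNIV. w $ l * (A *v \<alpha>) $ l) * det C"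
    by (simp add: det_weighted_gram)
  have "slice_B (weighted_sum w A B C) \<beta> = (\<chi> j k. \<Sum>l\<in>UNIV. (w $ l * (B *v \<beta>) $ l) * A $ l $ j * C $ l $ k)"
    using swap[of \<beta> "\<lambda>l. w $ l * A $ l $ _ * C $ l $ _" B]
    by (simp add: slice_B_def weighted_sum_def vec_eq_iff ac_simps)
  then show "det (slice_B (weighted_sum w A B C) \<beta>) = det A * (\<Prod>l\<in>UNIV. w $ l * (B *v \<beta>) $ l) * det C"
    by (simp add: det_weighted_gram)
  have "slice_C (weighted_sum w A B C) \<gamma> = (\<chi> j k. \<Sum>l\<in>UNIV. (w $ l * (C *v \<gamma>) $ l) * A $ l $ j * B $ l $ k)"
    using swap[of \<gamma> "\<lambda>l. w $ l * A $ l $ _ * B $ l $ _" C]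
    by (simp add: slice_C_def weighted_sum_def vec_eq_iff ac_simps)
  then show "det (slice_C (weighted_sum w A B C) \<gamma>) = det A * (\<Prod>l\<in>UNIV. w $ l * (C *v \<gamma>) $ l) * det B"
    by (simp add: det_weighted_gram)
qed

lemma rank_one_sum_weighted_sum:
  assumes "X \<in> rank_one_sums CARD('n)"
  shows "\<exists>A B C. (X :: 'n::finite tensor) = weighted_sum 1 A B C"
proof -
  obtain t where X: "X = (\<Sum>l<CARD('n). t l)" and t: "\<forall>l<CARD('n). rank_one (t l :: 'n tensor)"
    using assms unfolding rank_one_sums_def by blast
  have "\<forall>l. \<exists>a b c. l < CARD('n) \<longrightarrow> t l = outer a b c" using t unfolding rank_one_def by blast
  then obtain a b c where abc: "\<And>l. l < CARD('n) \<Longrightarrow> t l = outer (a l) (b l) (c l)" by metis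
  have "X = (\<Sum>l<CARD('n). outer (a l) (b l) (c l))" unfolding X using abc by simp
  also have "\<dots> = (\<Sum>l\<in>UNIV. outer (a (index_of (l :: 'n))) (b (index_of l)) (c (index_of l)))"
    by (subst sum_at_index[symmetric]) simp
  also have "\<dots> = weighted_sum 1 (\<chi> l. a (index_of l)) (\<chi> l. b (index_of l)) (\<chi> l. c (index_of l))"
    by (simp add: vec_eq_iff weighted_sum_def outer_def sum_component)
  finally show ?thesis by blast
qed

text \<open>When three slices are invertible, none of the factors is orthogonal to the dual vector that defines the
  slice, so each factor can be scaled to have value one there.\<close>

lemma normalized_weighted_sum:
  assumes dA: "det (slice_A (weighted_sum 1 A B C) \<alpha>) \<noteq> 0"
    and dB: "det (slice_B (weighted_sum 1 A B C) \<beta>) \<noteq> 0"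
    and dC: "det (slice_C (weighted_sum 1 A B C) \<gamma>) \<noteq> 0"
  shows "\<exists>w A' B' C'. weighted_sum 1 A B C = weighted_sum w A' B' C' \<and> A' *v \<alpha> = 1 \<and> B' *v \<beta> = 1 \<and> C' *v \<gamma> = 1
    \<and> det A' \<noteq> 0 \<and> det B' \<noteq> 0"
proof -
  have nz: "(A *v \<alpha>) $ l \<noteq> 0" "(B *v \<beta>) $ l \<noteq> 0" "(C *v \<gamma>) $ l \<noteq> 0" for l
    using dA dB dC by (simp_all add: det_slices_weighted_sum)
  let ?w = "(A *v \<alpha>) * (B *v \<beta>) * (C *v \<gamma>)"
  let ?n = "\<lambda>M v. \<chi> l. inverse ((M *v v) $ l) *s (M $ l)"
  have eq: "weighted_sum 1 A B C = weighted_sum ?w (?n A \<alpha>) (?n B \<beta>) (?n C \<gamma>)"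
    using nz by (simp add: weighted_sum_def vec_eq_iff field_simps)
  have one: "?n M v *v v = 1" if "\<And>l. (M *v v) $ l \<noteq> 0" for M :: "complex ^ 'a ^ 'a" and v
  proof -
    have "(?n M v *v v) $ l = inverse ((M *v v) $ l) * (M *v v) $ l" for l
      by (simp add: matrix_vector_mult_def sum_distrib_left mult.assoc)
    then show ?thesis using that by (simp add: vec_eq_iff)
  qed
  show ?thesis
    using eq one[OF nz(1)] one[OF nz(2)] one[OF nz(3)] dA dB unfolding eq
    by (intro exI[of _ ?w] exI[of _ "?n A \<alpha>"] exI[of _ "?n B \<beta>"] exI[of _ "?n C \<gamma>"])
      (auto simp: det_slices_weighted_sum)
qed

section \<open>The limit of the schemes of points\<close>

text \<open>The Segre cone is closed under scaling, and a polynomial in the scaling parameter that vanishes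
  identically has vanishing coefficients.\<close>

lemma homogeneous_part_segre_ideal:
  fixes f :: "('n::finite \<times> 'n \<times> 'n) cpoly"
  assumes "f \<in> segre_ideal"
  shows "homogeneous_part d f \<in> segre_ideal"
  unfolding segre_ideal_def
proof (intro CollectI allI)
  fix a b c :: "complex ^ 'n"
  let ?P = "tensor_coords (outer a b c)"
  obtain D where D: "\<And>d. d \<ge> D \<Longrightarrow> homogeneous_part d f = 0" and f: "f = (\<Sum>d<D. homogeneous_part d f)"
    by (rule sum_homogeneous_part[of f]) (rule that)
  show "poly_value (homogeneous_part d f) ?P = 0"
  proof (cases "d < D")
    case True
    have scaled: "tensor_coords (outer (t *s a) b c) = (\<lambda>p. t * ?P p)" for t
      by (auto simp: tensor_coords_def outer_def fun_eq_iff)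
    have "poly_value (homogeneous_part e f) (\<lambda>p. t * ?P p) = poly_value (homogeneous_part e f) ?P * t ^ e" for e t
    proof -
      have deg: "mono_degree u = e" if "u \<in> Poly_Mapping.keys (homogeneous_part e f)" for u
        using homogeneous_part_is_homogeneous[of e f] that unfolding homogeneous_iff by blast
      show ?thesis
        unfolding poly_value_def sum_distrib_right
        by (rule sum.cong[OF refl], drule deg)
          (auto simp: power_mult_distrib prod.distrib mono_degree_def power_sum)
    qed
    then have "poly_value f (\<lambda>p. t * ?P p) = (\<Sum>e<D. poly_value (homogeneous_part e f) ?P * t ^ e)" for t
      by (subst f) (simp add: poly_value_sum)
    moreover have "poly_value f (\<lambda>p. t * ?P p) = 0" for t
      using assms unfolding segre_ideal_def scaled[symmetric] by blast
    ultimately have "\<forall>t. (\<Sum>e\<le>D - 1. poly_value (homogeneous_part e f) ?P * t ^ e) = 0"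
      using True by (cases D) (simp_all add: lessThan_Suc_atMost)
    then show ?thesis using True unfolding polyfun_eq_0 by simp
  qed (simp add: D)
qed

text \<open>The tensors \<open>X n\<close> are spanned by the points with coordinates \<open>a\<^sub>l \<otimes> b\<^sub>l \<otimes> c\<^sub>l\<close>, where \<open>a\<^sub>l\<close>, \<open>b\<^sub>l\<close>, \<open>c\<^sub>l\<close> are the
  rows of \<open>A n\<close>, \<open>B n\<close>, \<open>C n\<close>.  The coordinate ring of these points is the componentwise product on
  vectors indexed by \<open>l\<close>.  The isomorphism \<open>A n\<close> identifies it with the space of dual vectors \<open>\<alpha>\<close>, whose
  standard basis stays fixed as \<open>n\<close> varies; the unit corresponds to \<open>\<alpha>0\<close>.\<close>

locale normalized_limit =
  fixes X :: "nat \<Rightarrow> 'n::finite tensor" and T :: "'n tensor"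
    and w :: "nat \<Rightarrow> complex ^ 'n" and A B C A' B' :: "nat \<Rightarrow> complex ^ 'n ^ 'n"
    and \<alpha>0 \<beta>0 \<gamma>0 :: "complex ^ 'n"
  assumes X: "X n = weighted_sum (w n) (A n) (B n) (C n)"
    and unit_A: "A n *v \<alpha>0 = 1" and unit_B: "B n *v \<beta>0 = 1" and unit_C: "C n *v \<gamma>0 = 1"
    and inv_A: "A n ** A' n = mat 1" "A' n ** A n = mat 1" and inv_B: "B n ** B' n = mat 1"
    and lim: "X \<longlonglongrightarrow> T"
    and det_A: "det (slice_A T \<alpha>0) \<noteq> 0" and det_B: "det (slice_B T \<beta>0) \<noteq> 0" and det_C: "det (slice_C T \<gamma>0) \<noteq> 0"
begin

lemma A_A' [simp]: "A n *v (A' n *v v) = v" and A'_A [simp]: "A' n *v (A n *v v) = v"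
  and B_B' [simp]: "B n *v (B' n *v v) = v"
  using matrix_mult_inverse_vector inv_A inv_B by blast+

text \<open>The symmetric form \<open>\<Sum>\<^sub>l w\<^sub>l x\<^sub>l y\<^sub>l\<close> of the algebra of points, applied to \<open>v\<close> and the values of \<open>\<gamma>\<close>.\<close>

definition pairing :: "nat \<Rightarrow> complex ^ 'n \<Rightarrow> complex ^ 'n \<Rightarrow> complex" where
  "pairing n v \<gamma> = (\<Sum>l\<in>UNIV. w n $ l * (v $ l * (C n *v \<gamma>) $ l))"

text \<open>The rows of \<open>A n\<close>, \<open>B n\<close>, \<open>C n\<close> need not converge, so functions on the points are tested by pairing
  them with dual vectors; these pairings are contractions of \<open>X n\<close> in the cases of interest.\<close>

definition converges :: "(nat \<Rightarrow> complex ^ 'n) \<Rightarrow> bool" where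
  "converges v \<longleftrightarrow> (\<forall>\<gamma>. convergent (\<lambda>n. pairing n (v n) \<gamma>))"

lemma trilinear_pairing:
  "trilinear (tensor_coords (X n)) \<alpha> \<beta> \<gamma> = pairing n ((A n *v \<alpha>) * (B n *v \<beta>)) \<gamma>"
  by (simp add: X trilinear_weighted_sum pairing_def)

text \<open>The coordinates of \<open>v\<close> in the basis given by \<open>A n\<close> solve a linear system whose matrix is a slice of
  \<open>X n\<close>, with the pairings of \<open>v\<close> on the right hand side.\<close>

lemma converges_imp_convergent_A:
  assumes "converges v" shows "convergent (\<lambda>n. A' n *v v n)"
proof (rule convergent_solution)
  show "(\<lambda>n. transpose (slice_B (X n) \<beta>0)) \<longlonglongrightarrow> transpose (slice_B T \<beta>0)"
    by (rule tendsto_transpose[OF tendsto_slice_B[OF lim]])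
  show "det (transpose (slice_B T \<beta>0)) \<noteq> 0" using det_B by simp
  fix k
  have "(transpose (slice_B (X n) \<beta>0) *v (A' n *v v n)) $ k = pairing n (v n) (axis k 1)" for n
    unfolding bilinear_axis(2)[symmetric] trilinear_slice_B[symmetric] trilinear_pairing by (simp add: unit_B)
  then show "convergent (\<lambda>n. (transpose (slice_B (X n) \<beta>0) *v (A' n *v v n)) $ k)"
    using assms by (simp add: converges_def)
qed

lemma converges_imp_convergent_B:
  assumes "converges v" shows "convergent (\<lambda>n. B' n *v v n)"
proof (rule convergent_solution)
  show "(\<lambda>n. transpose (slice_A (X n) \<alpha>0)) \<longlonglongrightarrow> transpose (slice_A T \<alpha>0)"
    by (rule tendsto_transpose[OF tendsto_slice_A[OF lim]])
  show "det (transpose (slice_A T \<alpha>0)) \<noteq> 0" using det_A by simp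
  fix k
  have "(transpose (slice_A (X n) \<alpha>0) *v (B' n *v v n)) $ k = pairing n (v n) (axis k 1)" for n
    unfolding bilinear_axis(2)[symmetric] trilinear_slice_A[symmetric] trilinear_pairing by (simp add: unit_A)
  then show "convergent (\<lambda>n. (transpose (slice_A (X n) \<alpha>0) *v (B' n *v v n)) $ k)"
    using assms by (simp add: converges_def)
qed

lemma convergent_trilinear:
  assumes "convergent \<alpha>" "convergent \<beta>" "convergent \<gamma>"
  shows "convergent (\<lambda>n. trilinear (tensor_coords (X n)) (\<alpha> n) (\<beta> n) (\<gamma> n))"
  using tendsto_trilinear[OF lim] assms unfolding convergent_def by blast

lemma converges_A: "convergent \<alpha> \<Longrightarrow> converges (\<lambda>n. A n *v \<alpha> n)"
  using convergent_trilinear[of \<alpha> "\<lambda>_. \<beta>0" "\<lambda>_. _"]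
  by (simp add: converges_def trilinear_pairing unit_B convergent_const)

lemma converges_B: "converges (\<lambda>n. B n *v \<beta>)"
  using convergent_trilinear[of "\<lambda>_. \<alpha>0" "\<lambda>_. \<beta>" "\<lambda>_. _"]
  by (simp add: converges_def trilinear_pairing unit_A convergent_const)

lemma converges_C: "converges (\<lambda>n. C n *v \<gamma>)"
proof -
  have "convergent (\<lambda>n. A' n *v (C n *v \<gamma>))"
  proof (rule convergent_solution)
    show "(\<lambda>n. transpose (slice_C (X n) \<gamma>0)) \<longlonglongrightarrow> transpose (slice_C T \<gamma>0)"
      by (rule tendsto_transpose[OF tendsto_slice_C[OF lim]])
    show "det (transpose (slice_C T \<gamma>0)) \<noteq> 0" using det_C by simp
    fix k
    have "(transpose (slice_C (X n) \<gamma>0) *v (A' n *v (C n *v \<gamma>))) $ k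
        = trilinear (tensor_coords (X n)) \<alpha>0 (axis k 1) \<gamma>" for n
      unfolding bilinear_axis(2)[symmetric] trilinear_slice_C[symmetric] trilinear_pairing
      by (simp add: unit_A unit_C pairing_def ac_simps)
    then show "convergent (\<lambda>n. (transpose (slice_C (X n) \<gamma>0) *v (A' n *v (C n *v \<gamma>))) $ k)"
      using convergent_trilinear[of "\<lambda>_. \<alpha>0" "\<lambda>_. axis k 1" "\<lambda>_. \<gamma>"] by (simp add: convergent_const)
  qed
  from converges_A[OF this] show ?thesis by simp
qed

text \<open>Write one factor as the values of dual vectors on the first tensor factor and the other as values on
  the second; the pairings of the product are then contractions of \<open>X n\<close>.\<close>

lemma converges_mult:
  assumes "converges u" "converges v" shows "converges (\<lambda>n. u n * v n)"
  using convergent_trilinear[OF converges_imp_convergent_A[OF assms(1)] converges_imp_convergent_B[OF assms(2)], of "\<lambda>_. _"]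
  by (simp add: converges_def trilinear_pairing convergent_const)

lemma converges_add:
  assumes "converges u" "converges v" shows "converges (\<lambda>n. u n + v n)"
proof -
  have "pairing n (u n + v n) \<gamma> = pairing n (u n) \<gamma> + pairing n (v n) \<gamma>" for n \<gamma>
    by (simp add: pairing_def algebra_simps sum.distrib)
  then show ?thesis using assms by (simp add: converges_def convergent_add)
qed

lemma converges_const: "converges (\<lambda>n. c *s 1)"
  using converges_A[of "\<lambda>_. c *s \<alpha>0"] by (simp add: vec.scale unit_A convergent_const)

definition point_values :: "nat \<Rightarrow> ('n \<times> 'n \<times> 'n) cpoly \<Rightarrow> complex ^ 'n" where
  "point_values n f = (\<chi> l. poly_value f (tensor_coords (outer (A n $ l) (B n $ l) (C n $ l))))"

lemma point_values_simps:
  "point_values n (f + g) = point_values n f + point_values n g"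
  "point_values n (f * g) = point_values n f * point_values n g"
  "point_values n (const_poly c) = c *s 1"
  "point_values n (segre_form \<alpha> \<beta> \<gamma>) = (A n *v \<alpha>) * (B n *v \<beta>) * (C n *v \<gamma>)"
  by (simp_all add: point_values_def vec_eq_iff poly_value_add poly_value_mult trilinear_outer_rows)

lemma converges_point_values: "converges (\<lambda>n. point_values n f)"
proof (induction f rule: cpoly_induct)
  case (const c)
  then show ?case by (simp add: point_values_simps converges_const)
next
  case (var p)
  obtain i j k where p: "p = (i, j, k)" by (cases p)
  have row: "(M *v axis i 1) $ l = M $ l $ i" for M :: "complex ^ 'n ^ 'n" and l i
    using sum_axis[of i 1 "\<lambda>i. M $ l $ i"] by (simp add: matrix_vector_mult_def mult.commute)
  have "point_values n (var p) = (A n *v axis i 1) * (B n *v axis j 1) * (C n *v axis k 1)" for n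
    by (simp add: point_values_def p vec_eq_iff row tensor_coords_def outer_def)
  then show ?case
    by (simp only:) (intro converges_mult converges_A converges_B converges_C convergent_const)
next
  case (add f g)
  then show ?case by (simp add: point_values_simps converges_add)
next
  case (mult f g)
  then show ?case by (simp add: point_values_simps converges_mult)
qed

text \<open>The residue class of \<open>f\<close> in the limit algebra.\<close>

definition limit_value :: "('n \<times> 'n \<times> 'n) cpoly \<Rightarrow> complex ^ 'n" where
  "limit_value f = lim (\<lambda>n. A' n *v point_values n f)"

lemma tendsto_limit_value: "(\<lambda>n. A' n *v point_values n f) \<longlonglongrightarrow> limit_value f"
  using converges_imp_convergent_A[OF converges_point_values] unfolding limit_value_def convergent_LIMSEQ_iff .

lemma limit_value_eqI: "(\<And>n. A' n *v point_values n f = v) \<Longrightarrow> limit_value f = v"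
  by (simp add: limit_value_def)

definition limit_structure :: structure_constants where
  "limit_structure i j k = lim (\<lambda>n. structure_of (transported_product (A n) (A' n)) i j k)"

lemma tendsto_limit_structure:
  "(\<lambda>n. structure_of (transported_product (A n) (A' n)) i j k) \<longlonglongrightarrow> limit_structure i j k"
proof -
  let ?v = "\<lambda>n. (A n *v axis (at_index i) 1) * (A n *v axis (at_index j) 1)"
  have "converges ?v" by (intro converges_mult converges_A convergent_const)
  then obtain z where "(\<lambda>n. A' n *v ?v n) \<longlonglongrightarrow> z"
    using converges_imp_convergent_A unfolding convergent_def by blast
  then have "(\<lambda>n. structure_of (transported_product (A n) (A' n)) i j k) \<longlonglongrightarrow> to_coords z k"
    unfolding structure_of_def transported_product_def by (rule tendsto_to_coords)
  then show ?thesis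
    unfolding limit_structure_def convergent_LIMSEQ_iff[symmetric] by (rule convergentI)
qed

lemma smoothable_limit_structure: "smoothable CARD('n) limit_structure"
  using transported_unital_comm_algebra[OF inv_A unit_A] transported_reduced_points[OF inv_A]
    tendsto_limit_structure to_coords_in by (intro smoothable_limit) auto

lemma limit_value_add: "limit_value (f + g) = limit_value f + limit_value g"
proof (rule LIMSEQ_unique[OF tendsto_limit_value])
  show "(\<lambda>n. A' n *v point_values n (f + g)) \<longlonglongrightarrow> limit_value f + limit_value g"
    using tendsto_add[OF tendsto_limit_value[of f] tendsto_limit_value[of g]]
    by (simp add: point_values_simps matrix_vector_right_distrib)
qed

lemma limit_value_mult:
  "to_coords (limit_value (f * g))
    = alg_mult CARD('n) limit_structure (to_coords (limit_value f)) (to_coords (limit_value g))"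
proof
  fix k
  show "to_coords (limit_value (f * g)) k
      = alg_mult CARD('n) limit_structure (to_coords (limit_value f)) (to_coords (limit_value g)) k"
  proof (rule LIMSEQ_unique)
    show "(\<lambda>n. to_coords (A' n *v point_values n (f * g)) k) \<longlonglongrightarrow> to_coords (limit_value (f * g)) k"
      by (intro tendsto_to_coords tendsto_limit_value)
    have "to_coords (A' n *v point_values n (f * g)) k
        = alg_mult CARD('n) (structure_of (transported_product (A n) (A' n)))
          (to_coords (A' n *v point_values n f)) (to_coords (A' n *v point_values n g)) k" for n
      unfolding alg_mult_transported by (simp add: transported_product_def point_values_simps)
    then show "(\<lambda>n. to_coords (A' n *v point_values n (f * g)) k)
        \<longlonglongrightarrow> alg_mult CARD('n) limit_structure (to_coords (limit_value f)) (to_coords (limit_value g)) k"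
      by (simp only:) (intro tendsto_alg_mult tendsto_limit_structure tendsto_to_coords tendsto_limit_value)
  qed
qed

lemma limit_value_const_mult: "limit_value (const_poly c * f) = c *s limit_value f"
proof (rule LIMSEQ_unique[OF tendsto_limit_value])
  have "A' n *v point_values n (const_poly c * f) = c *s (A' n *v point_values n f)" for n
    by (simp add: point_values_simps vec_scale_mult vec.scale)
  moreover have "(\<lambda>n. c *s (A' n *v point_values n f)) \<longlonglongrightarrow> c *s limit_value f"
    by (intro vec_tendstoI) (simp, intro tendsto_intros tendsto_vec_nth tendsto_limit_value)
  ultimately show "(\<lambda>n. A' n *v point_values n (const_poly c * f)) \<longlonglongrightarrow> c *s limit_value f" by simp
qed

lemma limit_value_0: "limit_value 0 = 0"
  using limit_value_add[of 0 0] by simp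

lemma limit_value_sum: "limit_value (\<Sum>i\<in>S. f i) = (\<Sum>i\<in>S. limit_value (f i))"
  by (induction S rule: infinite_finite_induct) (simp_all add: limit_value_0 limit_value_add)

lemma limit_value_diff: "limit_value (f - g) = limit_value f - limit_value g"
  using limit_value_add[of "f - g" g] by simp

lemma limit_value_mult_eq_0: "limit_value g = 0 \<Longrightarrow> limit_value (f * g) = 0"
  using limit_value_mult[of f g] by (simp add: to_coords_0 alg_mult_def flip: to_coords_eq_iff cong: if_cong)

abbreviation unit_form :: "('n \<times> 'n \<times> 'n) cpoly" where
  "unit_form \<equiv> segre_form \<alpha>0 \<beta>0 \<gamma>0"

lemma limit_value_unit_form_mult: "limit_value (unit_form * f) = limit_value f"
  by (simp add: limit_value_def point_values_simps unit_A unit_B unit_C)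

lemma limit_value_unit_form_power_mult: "limit_value (unit_form ^ k * f) = limit_value f"
  by (induction k) (simp_all add: limit_value_unit_form_mult mult.assoc)

lemma limit_value_segre_form: "limit_value (segre_form \<alpha> \<beta>0 \<gamma>0) = \<alpha>"
  by (rule limit_value_eqI) (simp add: point_values_simps unit_B unit_C)

text \<open>Polynomials in the Segre ideal vanish at all the points for every \<open>n\<close>, hence in the limit algebra.\<close>

lemma limit_value_segre_ideal: "f \<in> segre_ideal \<Longrightarrow> limit_value f = 0"
  by (rule limit_value_eqI) (simp add: segre_ideal_def point_values_def zero_vec_def[symmetric])

text \<open>For each \<open>n\<close> the value of a linear form at \<open>X n\<close> is the weighted sum of its values at the points, that
  is, the contraction of \<open>X n\<close> with \<open>\<beta>0\<close>, \<open>\<gamma>0\<close> and the residue class of the form.  So a linear form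
  with zero residue class in the limit vanishes at \<open>T\<close>.\<close>

lemma linear_form_value_limit:
  assumes "linear_form f"
  shows "poly_value f (tensor_coords T) = trilinear (tensor_coords T) (limit_value f) \<beta>0 \<gamma>0"
proof (rule LIMSEQ_unique)
  show "(\<lambda>n. poly_value f (tensor_coords (X n))) \<longlonglongrightarrow> poly_value f (tensor_coords T)"
    by (intro tendsto_poly_value tendsto_tensor_coords lim)
  have "poly_value f (tensor_coords (X n))
      = trilinear (tensor_coords (X n)) (A' n *v point_values n f) \<beta>0 \<gamma>0" for n
    using poly_value_linear_combination[OF assms, of "\<lambda>l. w n $ l"
        "\<lambda>l. tensor_coords (outer (A n $ l) (B n $ l) (C n $ l))" UNIV]
    by (simp add: trilinear_pairing unit_B unit_C pairing_def)
      (simp add: X tensor_coords_weighted_sum point_values_def)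
  then show "(\<lambda>n. poly_value f (tensor_coords (X n)))
      \<longlonglongrightarrow> trilinear (tensor_coords T) (limit_value f) \<beta>0 \<gamma>0"
    using tendsto_trilinear[OF lim tendsto_limit_value tendsto_const tendsto_const] by simp
qed

definition limit_ideal :: "('n \<times> 'n \<times> 'n) cpoly set" where
  "limit_ideal = {f. \<forall>d. limit_value (homogeneous_part d f) = 0}"

lemma limit_value_limit_ideal:
  assumes "f \<in> limit_ideal" shows "limit_value f = 0"
proof -
  obtain D where "f = (\<Sum>d<D. homogeneous_part d f)" by (rule sum_homogeneous_part)
  then have "limit_value f = (\<Sum>d<D. limit_value (homogeneous_part d f))" by (metis limit_value_sum)
  then show ?thesis using assms by (simp add: limit_ideal_def)
qed

lemma homogeneous_in_limit_ideal:
  assumes "homogeneous d f" "limit_value f = 0" shows "f \<in> limit_ideal"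
proof -
  have "homogeneous_part e f = (if e = d then f else 0)" for e
    using homogeneous_part_homogeneous_part[of e d f] assms(1) unfolding homogeneous_def by simp
  then show ?thesis using assms(2) limit_value_0 by (simp add: limit_ideal_def)
qed

lemma homogeneous_ideal_limit_ideal: "homogeneous_ideal limit_ideal"
  unfolding homogeneous_ideal_def poly_ideal_def
proof (intro conjI ballI allI)
  show "0 \<in> limit_ideal" by (simp add: limit_ideal_def limit_value_0)
  show "f + g \<in> limit_ideal" if "f \<in> limit_ideal" "g \<in> limit_ideal" for f g
    using that by (simp add: limit_ideal_def homogeneous_part_add limit_value_add)
  show "homogeneous_part d f \<in> limit_ideal" if "f \<in> limit_ideal" for f d
    by (rule homogeneous_in_limit_ideal[of d]) (use that in \<open>simp_all add: limit_ideal_def\<close>)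
  show "f * g \<in> limit_ideal" if g: "g \<in> limit_ideal" for f g
    unfolding limit_ideal_def
  proof (intro CollectI allI)
    fix d
    obtain D where D: "f = (\<Sum>e<D. homogeneous_part e f)" by (rule sum_homogeneous_part)
    have part: "limit_value (homogeneous_part d (homogeneous_part e f * g)) = 0" for e
    proof (cases "e \<le> d")
      case True
      then have "homogeneous_part d (homogeneous_part e f * g) = homogeneous_part e f * homogeneous_part (d - e) g"
        using homogeneous_part_mult[OF homogeneous_part_is_homogeneous, of e "d - e" f g] by simp
      then show ?thesis using g limit_value_mult_eq_0 by (simp add: limit_ideal_def)
    next
      case False
      then show ?thesis
        using homogeneous_part_mult_small[OF homogeneous_part_is_homogeneous, of d e f g] limit_value_0 by simp
    qed
    have "f * g = (\<Sum>e<D. homogeneous_part e f * g)" by (subst D) (simp add: sum_distrib_right)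
    then show "limit_value (homogeneous_part d (f * g)) = 0"
      by (simp add: homogeneous_part_sum limit_value_sum part)
  qed
qed

lemma unit_form_not_zero_divisor:
  assumes "unit_form * f \<in> limit_ideal" shows "f \<in> limit_ideal"
  unfolding limit_ideal_def
proof (intro CollectI allI)
  fix d
  have "homogeneous 1 unit_form" using linear_form_segre_form by (simp add: linear_form_iff_homogeneous)
  then have "homogeneous_part (1 + d) (unit_form * f) = unit_form * homogeneous_part d f"
    by (rule homogeneous_part_mult)
  moreover have "limit_value (homogeneous_part (1 + d) (unit_form * f)) = 0"
    using assms by (simp add: limit_ideal_def)
  ultimately show "limit_value (homogeneous_part d f) = 0" by (simp add: limit_value_unit_form_mult)
qed

text \<open>The form \<open>unit_form\<close> has residue class one, so multiplying the homogeneous parts of a polynomial by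
  powers of it makes the polynomial homogeneous without changing its residue class.\<close>

lemma dehomogenization_limit_ideal:
  "{f. limit_value f = 0} = {f + g * (unit_form - 1) | f g. f \<in> limit_ideal}"
proof (intro set_eqI iffI)
  fix f assume "f \<in> {f + g * (unit_form - 1) | f g. f \<in> limit_ideal}"
  then obtain h g where f: "f = h + g * (unit_form - 1)" and h: "h \<in> limit_ideal" by blast
  have "limit_value (g * (unit_form - 1)) = limit_value (unit_form * g) - limit_value g"
    by (simp add: limit_value_diff[symmetric] algebra_simps)
  then show "f \<in> {f. limit_value f = 0}"
    by (simp add: f limit_value_add limit_value_limit_ideal[OF h] limit_value_unit_form_mult)
next
  fix f assume "f \<in> {f. limit_value f = 0}"
  then have f0: "limit_value f = 0" by simp
  obtain D where D: "f = (\<Sum>d<D. homogeneous_part d f)" by (rule sum_homogeneous_part)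
  let ?F = "\<Sum>d<D. unit_form ^ (D - d) * homogeneous_part d f"
  have l1: "homogeneous 1 unit_form" using linear_form_segre_form by (simp add: linear_form_iff_homogeneous)
  have "homogeneous D ?F"
  proof (rule homogeneous_sum)
    fix d assume "d \<in> {..<D}"
    then show "homogeneous D (unit_form ^ (D - d) * homogeneous_part d f)"
      using homogeneous_mult[OF homogeneous_power[OF l1, of "D - d"] homogeneous_part_is_homogeneous[of d f]] by simp
  qed
  moreover have "limit_value ?F = 0"
  proof -
    have "limit_value ?F = limit_value (\<Sum>d<D. homogeneous_part d f)"
      by (simp add: limit_value_sum limit_value_unit_form_power_mult)
    then show ?thesis using f0 D by simp
  qed
  ultimately have F: "?F \<in> limit_ideal" by (rule homogeneous_in_limit_ideal)
  have "unit_form - 1 dvd unit_form ^ k * h - h" for k h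
  proof (induction k)
    case (Suc k)
    have "unit_form ^ Suc k * h - h = (unit_form - 1) * (unit_form ^ k * h) + (unit_form ^ k * h - h)"
      by (simp add: algebra_simps)
    then show ?case using Suc by (metis dvd_add dvd_triv_left)
  qed simp
  then have "unit_form - 1 dvd (\<Sum>d<D. unit_form ^ (D - d) * homogeneous_part d f - homogeneous_part d f)"
    by (intro dvd_sum)
  then have "unit_form - 1 dvd ?F - f" using D by (simp add: sum_subtractf)
  then obtain g where "?F - f = (unit_form - 1) * g" by (rule dvdE)
  then have "f = ?F + (- g) * (unit_form - 1)" by (simp add: algebra_simps)
  then show "f \<in> {f + g * (unit_form - 1) | f g. f \<in> limit_ideal}" using F by blast
qed

lemma smoothable_rank_le: "smoothable_rank T \<le> enat CARD('n)"
proof -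
  have "quotient_algebra {f + g * (unit_form - 1) | f g. f \<in> limit_ideal} CARD('n) limit_structure"
    unfolding quotient_algebra_def
  proof (intro exI conjI allI)
    let ?q = "\<lambda>f. to_coords (limit_value f)"
    show "range ?q = coord_space CARD('n)"
    proof (intro equalityI subsetI)
      fix x assume "x \<in> coord_space CARD('n)"
      then obtain v :: "complex ^ 'n" where "x = to_coords v" by (rule coord_space_cases)
      then have "x = ?q (segre_form v \<beta>0 \<gamma>0)" by (simp add: limit_value_segre_form)
      then show "x \<in> range ?q" by blast
    qed auto
    show "?q (f + g) = (\<lambda>i. ?q f i + ?q g i)" for f g by (simp add: limit_value_add to_coords_add)
    show "?q (const_poly c * f) = (\<lambda>i. c * ?q f i)" for c f
      by (simp add: limit_value_const_mult to_coords_scale)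
    show "?q (f * g) = alg_mult CARD('n) limit_structure (?q f) (?q g)" for f g by (rule limit_value_mult)
    show "{f. ?q f = (\<lambda>i. 0)} = {f + g * (unit_form - 1) | f g. f \<in> limit_ideal}"
      using to_coords_eq_iff[of "limit_value _" 0] dehomogenization_limit_ideal unfolding to_coords_0 by simp
  qed
  then have "zero_dim_scheme limit_ideal CARD('n) limit_structure"
    unfolding zero_dim_scheme_def
    by (intro conjI exI[of _ unit_form] allI impI homogeneous_ideal_limit_ideal linear_form_segre_form)
      (rule unit_form_not_zero_divisor)
  moreover have "segre_ideal \<subseteq> limit_ideal"
    using limit_value_segre_ideal homogeneous_part_segre_ideal unfolding limit_ideal_def by blast
  moreover have "T \<in> linear_span limit_ideal"
    unfolding linear_span_def
  proof (intro CollectI ballI impI)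
    fix f assume "f \<in> limit_ideal" "linear_form f"
    then show "poly_value f (tensor_coords T) = 0"
      by (simp add: linear_form_value_limit limit_value_limit_ideal) (simp add: trilinear_def)
  qed
  ultimately show ?thesis
    unfolding smoothable_rank_def using smoothable_limit_structure by (intro Inf_lower) blast
qed

end

section \<open>Wild tensors of minimal border rank\<close>

lemma Inf_enat_mem:
  fixes S :: "enat set"
  assumes "Inf S \<noteq> \<infinity>"
  shows "Inf S \<in> S"
  using assms unfolding Inf_enat_def by (auto intro: LeastI split: if_splits)

text \<open>Approximating sums of rank one tensors inherit invertible slices from \<open>T\<close>, eventually; they can then be
  normalized.\<close>

lemma smoothable_rank_le_if_one_generic:
  fixes T :: "'n::finite tensor"
  assumes "one_generic T" and closure: "T \<in> closure (rank_one_sums CARD('n))"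
  shows "smoothable_rank T \<le> enat CARD('n)"
proof -
  obtain \<alpha> \<beta> \<gamma> where d: "det (slice_A T \<alpha>) \<noteq> 0" "det (slice_B T \<beta>) \<noteq> 0" "det (slice_C T \<gamma>) \<noteq> 0"
    using assms(1) unfolding one_generic_def one_A_generic_def one_B_generic_def one_C_generic_def
    by (auto simp: full_rank_iff_det)
  obtain Y where Y: "\<And>n. Y n \<in> rank_one_sums CARD('n)" "Y \<longlonglongrightarrow> T"
    using closure unfolding closure_sequential by blast
  have "\<forall>\<^sub>F n in sequentially. det (slice_A (Y n) \<alpha>) \<noteq> 0 \<and> det (slice_B (Y n) \<beta>) \<noteq> 0 \<and> det (slice_C (Y n) \<gamma>) \<noteq> 0"
    by (intro eventually_conj tendsto_imp_eventually_ne[OF tendsto_det[OF tendsto_slice_A[OF Y(2)]] d(1)]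
        tendsto_imp_eventually_ne[OF tendsto_det[OF tendsto_slice_B[OF Y(2)]] d(2)]
        tendsto_imp_eventually_ne[OF tendsto_det[OF tendsto_slice_C[OF Y(2)]] d(3)])
  then obtain n0 where n0: "\<And>n. n \<ge> n0 \<Longrightarrow>
      det (slice_A (Y n) \<alpha>) \<noteq> 0 \<and> det (slice_B (Y n) \<beta>) \<noteq> 0 \<and> det (slice_C (Y n) \<gamma>) \<noteq> 0"
    unfolding eventually_sequentially by blast
  define X where "X n = Y (n + n0)" for n
  have lim: "X \<longlonglongrightarrow> T" unfolding X_def using Y(2) by (rule LIMSEQ_ignore_initial_segment)
  have "\<forall>n. \<exists>w A B C A' B'. X n = weighted_sum w A B C \<and> A *v \<alpha> = 1 \<and> B *v \<beta> = 1 \<and> C *v \<gamma> = 1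
      \<and> A ** A' = mat 1 \<and> A' ** A = mat 1 \<and> B ** B' = mat 1"
  proof
    fix n
    obtain A B C where Xn: "X n = weighted_sum 1 A B C"
      using rank_one_sum_weighted_sum[OF Y(1)] unfolding X_def by blast
    have "det (slice_A (X n) \<alpha>) \<noteq> 0" "det (slice_B (X n) \<beta>) \<noteq> 0" "det (slice_C (X n) \<gamma>) \<noteq> 0"
      using n0[of "n + n0"] by (simp_all add: X_def)
    then obtain w A' B' C' where *: "X n = weighted_sum w A' B' C'" "A' *v \<alpha> = 1" "B' *v \<beta> = 1" "C' *v \<gamma> = 1"
      "invertible A'" "invertible B'"
      using normalized_weighted_sum[of A B C \<alpha> \<beta> \<gamma>] unfolding Xn invertible_det_nz by blast
    then show "\<exists>w A B C A' B'. X n = weighted_sum w A B C \<and> A *v \<alpha> = 1 \<and> B *v \<beta> = 1 \<and> C *v \<gamma> = 1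
        \<and> A ** A' = mat 1 \<and> A' ** A = mat 1 \<and> B ** B' = mat 1"
      unfolding invertible_def by blast
  qed
  then obtain w A B C A' B' where *: "\<forall>n. X n = weighted_sum (w n) (A n) (B n) (C n)
      \<and> A n *v \<alpha> = 1 \<and> B n *v \<beta> = 1 \<and> C n *v \<gamma> = 1
      \<and> A n ** A' n = mat 1 \<and> A' n ** A n = mat 1 \<and> B n ** B' n = mat 1"
    unfolding choice_iff by blast
  interpret normalized_limit X T w A B C A' B' \<alpha> \<beta> \<gamma>
    by unfold_locales (use * lim d in blast)+
  show ?thesis by (rule smoothable_rank_le)
qed

theorem theorem1p8:
  fixes T :: "complex ^ 'n::finite ^ 'n ^ 'n"
  assumes "concise T"
    and "border_rank T = enat (CARD('n))"
  shows "(wild T \<longleftrightarrow> one_star_degenerate T) \<and> (wild T \<longleftrightarrow> \<not> one_generic T)"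
proof -
  have closure: "T \<in> closure (rank_one_sums CARD('n))"
  proof -
    let ?S = "{enat r | r. T \<in> closure (rank_one_sums r)}"
    have Inf: "Inf ?S = enat CARD('n)" using assms(2) by (simp add: border_rank_def)
    then have "Inf ?S \<in> ?S" by (intro Inf_enat_mem) simp
    with Inf show ?thesis by simp
  qed
  have "smoothable_rank T \<le> enat CARD('n) \<longleftrightarrow> one_generic T"
  proof
    assume le: "smoothable_rank T \<le> enat CARD('n)"
    then have "smoothable_rank T \<noteq> \<infinity>" by (cases "smoothable_rank T") auto
    then obtain r I \<mu> where "smoothable_rank T = enat r" "zero_dim_scheme I r \<mu>"
      "segre_ideal \<subseteq> I" "T \<in> linear_span I"
      using Inf_enat_mem unfolding smoothable_rank_def by blast
    with le show "one_generic T" using one_generic_of_scheme[OF assms(1)] by simp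
  qed (rule smoothable_rank_le_if_one_generic[OF _ closure])
  then have "wild T \<longleftrightarrow> \<not> one_generic T"
    by (simp add: wild_def assms(2) flip: not_le)
  moreover have "one_star_degenerate T \<longleftrightarrow> \<not> one_generic T"
    by (simp add: one_star_degenerate_def one_generic_def)
  ultimately show ?thesis by blast
qed

end
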